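(* Let $\xi\ge1$ be a countable ordinal, $\Sigma=\{\alpha_1,\alpha_2,\dots\}$ an infinite countable alphabet, $\upsilon\notin\Sigma$ a variable and $\vec k=(k_n)_{n\in\mathbb N}\subseteq\mathbb N$ an increasing sequence. For every family $\mathcal G\subseteq L^{<\infty}(\Sigma,\vec k)$ and every $\vec w\in L^\infty(\Sigma,\vec k;\upsilon)$ there exists an extraction $\vec u\prec\vec w$ such that either $L^\xi(\Sigma,\vec k)\cap E^{<\infty}(\vec u)\subseteq\mathcal G$, or $L^\xi(\Sigma,\vec k)\cap E^{<\infty}(\vec u)\subseteq L^{<\infty}(\Sigma,\vec k)\setminus\mathcal G$.
   Context: $\mathbb N=\{1,2,\dots\}$. $L(\Sigma,\vec k)$: functions $w$ from a nonempty finite $\mathrm{dom}(w)\subseteq\mathbb N$ into $\Sigma$ with $w(n)\in\{\alpha_1,\dots,\alpha_{k_n}\}$; $L(\Sigma,\vec k;\upsilon)$: functions $w$ from a nonempty finite $\mathrm{dom}(w)\subseteq\mathbb N$ into $\Sigma\cup\{\upsilon\}$ with $w(n)\in\{\upsilon,\alpha_1,\dots,\alpha_{k_n}\}$ and $\upsilon$ attained. $w<u$ iff $\max\mathrm{dom}(w)<\min\mathrm{dom}(u)$, and then $w\star u$ is the word on $\mathrm{dom}(w)\cup\mathrm{dom}(u)$ agreeing with $w,u$. $T_0(w)=w$; for $p\in\mathbb N$, $T_p(w)$ replaces each $\upsilon$ at position $n$ by $\alpha_{\min(p,k_n)}$. $L^\infty(\Sigma,\vec k;\upsilon)$: sequences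 $(w_n)$ in $L(\Sigma,\vec k;\upsilon)$ with $w_n<w_{n+1}$. $EV(\vec w)$: all words $T_{p_1}(w_{n_1})\star\cdots\star T_{p_\lambda}(w_{n_\lambda})$, $\lambda\in\mathbb N$, $n_1<\dots<n_\lambda$, integers $0\le p_i\le k_{n_i}$, some $p_i=0$; $E(\vec w)$: such words with all $1\le p_i\le k_{n_i}$. $\vec u\prec\vec w$ iff $\vec u\in L^\infty(\Sigma,\vec k;\upsilon)$ with all terms in $EV(\vec w)$. $L^{<\infty}(\Sigma,\vec k)$: $\emptyset$ and all tuples $(w_1,\dots,w_l)$, $w_1<\dots<w_l$ in $L(\Sigma,\vec k)$; $E^{<\infty}(\vec u)$: $\emptyset$ and such tuples with all terms in $E(\vec u)$. Schreier families $\mathcal A_\xi$ ($\xi<\omega_1$) of finite subsets of $\mathbb N$: fix for each nonzero countable limit $\lambda$ a strictly increasing sequence $(\lambda_n)$ of successor ordinals with supremum $\lambda$; with $s_1<s_2$ meaning $\max s_1<\min s_2$: $\mathcal A_0=\{\emptyset\}$, $\mathcal A_1=\{\{n\}\}$; $\mathcal A_{\zeta+1}=\{\{n\}\cup s_1:\{n\}<s_1,\ s_1\in\mathcal A_\zeta\}$; $\mathcal A_{\omega^{\beta+1}}=\{s_1\cup\dots\cup s_n:n=\min s_1,\ s_1<\dots<s_n\in\mathcal A_{\omega^\beta}\}$; for limit $\lambda>0$, $\mathcal A_{\omega^\lambda}=\{s\neq\emptyset:s\in\mathcal A_{\omega^{\lambda_n}},\ n=\min s\}$; for limit $\xi=\omega^\alpha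 p+\sum_{i=1}^m\omega^{a_i}p_i$ with $\omega^\alpha<\xi<\omega^{\alpha+1}$, $\alpha>a_1>\dots>a_m>0$, $p,p_i\ge1$: $\mathcal A_\xi$ consists of $s_0\cup\bigcup_{i=1}^m s_i$ with $s_m<\dots<s_1<s_0$, $s_0$ a union of $p$ successive members of $\mathcal A_{\omega^\alpha}$ and each $s_i$ a union of $p_i$ successive members of $\mathcal A_{\omega^{a_i}}$. $L^\xi(\Sigma,\vec k)$ ($\xi\ge1$) is the set of $(w_1,\dots,w_l)\in L^{<\infty}(\Sigma,\vec k)$ with $\{\min\mathrm{dom}(w_1),\dots,\min\mathrm{dom}(w_l)\}\in\mathcal A_\xi$. *)

theory Defs
  imports "HOL-Library.Countable_Set"
begin

section \<open>Countable ordinals\<close>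

text \<open>The order types of the well-orders whose field is a set of natural numbers.\<close>

quotient_type cord = "nat rel" /
  partial: "\<lambda>r s. Well_order r \<and> Well_order s \<and> (r, s) \<in> ordIso"
proof (rule part_equivpI)
  show "\<exists>r :: nat rel. Well_order r \<and> Well_order r \<and> (r, r) \<in> ordIso"
    by (rule exI[of _ "{}"]) (simp add: ordIso_reflexive)
  show "symp (\<lambda>r s :: nat rel. Well_order r \<and> Well_order s \<and> (r, s) \<in> ordIso)"
    by (auto intro!: sympI ordIso_symmetric)
  show "transp (\<lambda>r s :: nat rel. Well_order r \<and> Well_order s \<and> (r, s) \<in> ordIso)"
    by (auto intro!: transpI intro: ordIso_transitive)
qed

lemma cord_rep: obtains r where "Well_order r" "c = abs_cord r"
proof
  show "Well_order (rep_cord c)" using Quotient_rep_reflp[OF Quotient_cord, of c] by simp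
  show "c = abs_cord (rep_cord c)" by (rule Quotient_abs_rep[OF Quotient_cord, symmetric])
qed

instantiation cord :: wellorder
begin

lift_definition less_eq_cord :: "cord \<Rightarrow> cord \<Rightarrow> bool" is "\<lambda>r s. (r, s) \<in> ordLeq"
  by (meson ordIso_ordLeq_trans ordIso_symmetric ordLeq_ordIso_trans)

lift_definition less_cord :: "cord \<Rightarrow> cord \<Rightarrow> bool" is "\<lambda>r s. (r, s) \<in> ordLess"
  by (meson ordIso_ordLess_trans ordIso_symmetric ordLess_ordIso_trans)

instance
proof
  fix x y z :: cord
  show "x < y \<longleftrightarrow> x \<le> y \<and> \<not> y \<le> x"
    by transfer (use not_ordLeq_iff_ordLess ordLess_imp_ordLeq in blast)
  show "x \<le> x"
    by transfer (simp add: ordLeq_reflexive)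
  show "x \<le> y \<Longrightarrow> y \<le> z \<Longrightarrow> x \<le> z"
    by transfer (rule ordLeq_transitive)
  show "x \<le> y \<Longrightarrow> y \<le> x \<Longrightarrow> x = y"
    by transfer (simp add: ordIso_iff_ordLeq)
  show "x \<le> y \<or> y \<le> x"
    by transfer (simp add: ordLeq_total)
next
  fix P :: "cord \<Rightarrow> bool" and a :: cord
  assume step: "\<And>x. (\<And>y. y < x \<Longrightarrow> P y) \<Longrightarrow> P x"
  have *: "Well_order r \<Longrightarrow> P (abs_cord r)" for r :: "nat rel"
  proof (induction r rule: wf_induct_rule[OF wf_ordLess])
    case (1 r)
    show ?case
    proof (rule step)
      fix y assume y: "y < abs_cord r"
      obtain s where s: "Well_order s" "y = abs_cord s" by (rule cord_rep)
      have "(s, r) \<in> ordLess"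
        using y s 1(2) by (simp add: less_cord.abs_eq ordIso_reflexive)
      then show "P y" using 1(1) s by blast
    qed
  qed
  show "P a" by (rule cord_rep[of a]) (simp add: *)
qed

end

instantiation cord :: conditionally_complete_linorder
begin

definition inf_cord :: "cord \<Rightarrow> cord \<Rightarrow> cord" where "inf_cord = min"
definition sup_cord :: "cord \<Rightarrow> cord \<Rightarrow> cord" where "sup_cord = max"
definition Inf_cord :: "cord set \<Rightarrow> cord" where "Inf_cord X = (LEAST x. x \<in> X)"
definition Sup_cord :: "cord set \<Rightarrow> cord" where "Sup_cord X = (LEAST y. \<forall>x\<in>X. x \<le> y)"

instance
proof
  fix x y z :: cord and X :: "cord set"
  show "inf x y \<le> x" "inf x y \<le> y" "x \<le> y \<Longrightarrow> x \<le> z \<Longrightarrow> x \<le> inf y z"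
    "x \<le> sup x y" "y \<le> sup x y" "y \<le> x \<Longrightarrow> z \<le> x \<Longrightarrow> sup y z \<le> x"
    by (simp_all add: inf_cord_def sup_cord_def)
  show "x \<in> X \<Longrightarrow> Inf X \<le> x"
    by (simp add: Inf_cord_def Least_le)
  show "z \<le> Inf X" if ne: "X \<noteq> {}" and le: "\<And>x. x \<in> X \<Longrightarrow> z \<le> x"
  proof -
    have "(LEAST x. x \<in> X) \<in> X" by (rule LeastI_ex) (use ne in blast)
    then show ?thesis unfolding Inf_cord_def by (rule le)
  qed
  show "x \<le> Sup X" if x: "x \<in> X" and bdd: "bdd_above X"
  proof -
    have "\<forall>x\<in>X. x \<le> (LEAST y. \<forall>x\<in>X. x \<le> y)"
      by (rule LeastI_ex) (use bdd in \<open>simp add: bdd_above_def\<close>)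
    then show ?thesis unfolding Sup_cord_def using x by blast
  qed
  show "Sup X \<le> z" if "X \<noteq> {}" and le: "\<And>x. x \<in> X \<Longrightarrow> x \<le> z"
    unfolding Sup_cord_def by (rule Least_le) (use le in blast)
qed

end

text \<open>Suprema are only used for countable sets; these are bounded in \<^typ>\<open>cord\<close>
  (\<open>countable_bdd_above_cord\<close>).\<close>

lemma abs_cord_less_iff:
  "Well_order r \<Longrightarrow> Well_order s \<Longrightarrow> abs_cord r < abs_cord s \<longleftrightarrow> (r, s) \<in> ordLess"
  by (simp add: less_cord.abs_eq ordIso_reflexive)

lemma abs_cord_eqI:
  "Well_order r \<Longrightarrow> Well_order s \<Longrightarrow> (r, s) \<in> ordIso \<Longrightarrow> abs_cord r = abs_cord s"
  by (rule Quotient_rel_abs[OF Quotient_cord]) simp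

lemma Well_order_Restr_underS: "Well_order r \<Longrightarrow> Well_order (Restr r (underS r a))"
  by (simp add: Well_order_Restr)

lemma abs_cord_underS_less_iff:
  assumes r: "Well_order (r :: nat rel)" and a: "a \<in> Field r" and b: "b \<in> Field r"
  shows "abs_cord (Restr r (underS r a)) < abs_cord (Restr r (underS r b)) \<longleftrightarrow> a \<noteq> b \<and> (a, b) \<in> r"
proof -
  have wo: "wo_rel r" using r by (simp add: wo_rel_def)
  note TRANS = wo_rel.TRANS[OF wo] and ANTISYM = wo_rel.ANTISYM[OF wo] and TOTALS = wo_rel.TOTALS[OF wo]
  have "underS r a \<subset> underS r b \<longleftrightarrow> a \<noteq> b \<and> (a, b) \<in> r"
  proof
    assume ab: "a \<noteq> b \<and> (a, b) \<in> r"
    then have "underS r a \<subseteq> underS r b"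
      unfolding underS_def using transD[OF TRANS] antisymD[OF ANTISYM] by blast
    moreover have "a \<in> underS r b" "a \<notin> underS r a" using ab by (auto simp: underS_def)
    ultimately show "underS r a \<subset> underS r b" by blast
  next
    assume *: "underS r a \<subset> underS r b"
    have "(b, a) \<notin> r" if "a \<noteq> b"
    proof
      assume "(b, a) \<in> r"
      then have "b \<in> underS r a" using that by (auto simp: underS_def)
      then show False using * by (auto simp: underS_def)
    qed
    then show "a \<noteq> b \<and> (a, b) \<in> r" using TOTALS a b * by blast
  qed
  then show ?thesis
    using ofilter_subset_ordLess[OF r wo_rel.underS_ofilter[OF wo] wo_rel.underS_ofilter[OF wo], of a b]
    by (simp add: abs_cord_less_iff Well_order_Restr_underS r)
qed

lemma lessThan_abs_cord:
  assumes r: "Well_order (r :: nat rel)"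
  shows "{..<abs_cord r} = (\<lambda>a. abs_cord (Restr r (underS r a))) ` Field r"
proof (intro set_eqI iffI)
  fix x assume x: "x \<in> {..<abs_cord r}"
  obtain s where s: "Well_order s" "x = abs_cord s" by (rule cord_rep)
  then have "(s, r) \<in> ordLess" using x r by (simp add: abs_cord_less_iff)
  then obtain a where a: "a \<in> Field r" "(s, Restr r (underS r a)) \<in> ordIso"
    using ordLess_iff_ordIso_Restr[OF r s(1)] by blast
  then have "x = abs_cord (Restr r (underS r a))"
    unfolding s(2) by (intro abs_cord_eqI s(1) Well_order_Restr_underS r)
  then show "x \<in> (\<lambda>a. abs_cord (Restr r (underS r a))) ` Field r" using a by blast
next
  fix x assume "x \<in> (\<lambda>a. abs_cord (Restr r (underS r a))) ` Field r"
  then obtain a where "a \<in> Field r" "x = abs_cord (Restr r (underS r a))" by blast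
  then show "x \<in> {..<abs_cord r}"
    using underS_Restr_ordLess[OF r, of a] r
    by (auto simp: abs_cord_less_iff Well_order_Restr_underS)
qed

lemma countable_lessThan_cord: "countable {..<c :: cord}"
  by (rule cord_rep[of c]) (simp add: lessThan_abs_cord)

lemma uncountable_cord: "uncountable (UNIV :: cord set)"
proof
  assume "countable (UNIV :: cord set)"
  then obtain h :: "cord \<Rightarrow> nat" where h: "inj h" by (rule countableE)
  define W where "W = {(x, y). x \<le> (y :: cord)}"
  have FW: "Field W = UNIV" by (auto simp: W_def Field_def)
  have "W - Id = {(x, y). x < y}" by (auto simp: W_def)
  then have "wf (W - Id)" using wf by simp
  moreover have "refl_on UNIV W" "trans W" "antisym W" "total_on UNIV W"
    unfolding W_def refl_on_def trans_def antisym_def total_on_def by auto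
  ultimately have W: "Well_order W"
    unfolding well_order_on_def linear_order_on_def partial_order_on_def preorder_on_def FW
    by simp
  let ?R = "dir_image W h"
  have R: "Well_order ?R" and WR: "(W, ?R) \<in> ordIso"
    using W h by (auto intro!: Well_order_dir_image dir_image_ordIso simp: FW)
  let ?C = "abs_cord ?R" let ?f = "\<lambda>a. abs_cord (Restr ?R (underS ?R a))"
  let ?S = "Restr W (underS W ?C)"
  have uS: "underS W ?C = {..<?C}" by (auto simp: underS_def W_def)
  have FS: "Field ?S = {..<?C}" unfolding uS by (auto simp: Field_def W_def)
  have mono: "?f a < ?f b \<longleftrightarrow> a \<noteq> b \<and> (a, b) \<in> ?R" if "a \<in> Field ?R" "b \<in> Field ?R" for a b
    by (rule abs_cord_underS_less_iff[OF R that])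
  have rf: "(a, a) \<in> ?R" if "a \<in> Field ?R" for a
    using R that by (auto simp: well_order_on_def linear_order_on_def partial_order_on_def
        preorder_on_def refl_on_def)
  have tot: "(a, b) \<in> ?R \<or> (b, a) \<in> ?R" if "a \<in> Field ?R" "b \<in> Field ?R" for a b
    using R that rf unfolding well_order_on_def linear_order_on_def total_on_def by metis
  have inj: "inj_on ?f (Field ?R)"
    by (rule inj_onI) (metis mono tot less_irrefl)
  have le: "?f a \<le> ?f b \<longleftrightarrow> (a, b) \<in> ?R" if "a \<in> Field ?R" "b \<in> Field ?R" for a b
    using mono[OF that] inj rf that by (auto simp: le_less inj_on_def)
  have "bij_betw ?f (Field ?R) (Field ?S)"
    unfolding FS lessThan_abs_cord[OF R] using inj by (simp add: bij_betw_def)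
  moreover have "(a, b) \<in> ?R \<longleftrightarrow> (?f a, ?f b) \<in> ?S" if "a \<in> Field ?R" "b \<in> Field ?R" for a b
  proof -
    have "?f a \<in> {..<?C}" "?f b \<in> {..<?C}" using lessThan_abs_cord[OF R] that by blast+
    then show ?thesis using le[OF that] unfolding uS by (simp add: W_def)
  qed
  ultimately have "iso ?R ?S ?f" by (auto simp: iso_iff2)
  then have "(?R, ?S) \<in> ordIso"
    unfolding ordIso_def using R W by (auto simp: Well_order_Restr)
  moreover have "(?S, W) \<in> ordLess"
    using underS_Restr_ordLess[OF W] FW by simp
  ultimately show False
    using WR by (meson ordIso_ordLess_trans ordLess_ordIso_trans ordLess_irreflexive)
qed

lemma countable_bdd_above_cord:
  fixes X :: "cord set"
  assumes "countable X"
  shows "bdd_above X"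
proof (rule ccontr)
  assume n: "\<not> bdd_above X"
  have "\<exists>x\<in>X. y < x" for y
    using n unfolding bdd_above_def by (metis not_le)
  then have "UNIV = (\<Union>x\<in>X. {..<x})" by blast
  moreover have "countable (\<Union>x\<in>X. {..<x})"
    using assms by (simp add: countable_lessThan_cord)
  ultimately show False using uncountable_cord by simp
qed

section \<open>Ordinal arithmetic\<close>

text \<open>\<open>cord_add x y = sup ({x} \<union> {cord_add x z + 1 | z < y})\<close>, the successor being given by the
  order.\<close>

function cord_add :: "cord \<Rightarrow> cord \<Rightarrow> cord" where
  "cord_add x y = Sup (insert x ((\<lambda>z. LEAST c. cord_add x z < c) ` {..<y}))"
  by pat_completeness auto
termination by (relation "inv_image {(y, y'). y < y'} snd") (rule wf_inv_image[OF wf], simp)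

declare cord_add.simps [simp del]

text \<open>\<open>cord_mult x y = sup {x * z + x | z < y}\<close>: the order type of \<open>y\<close> copies of \<open>x\<close>.\<close>

function cord_mult :: "cord \<Rightarrow> cord \<Rightarrow> cord" where
  "cord_mult x y = Sup ((\<lambda>z. cord_add (cord_mult x z) x) ` {..<y})"
  by pat_completeness auto
termination by (relation "inv_image {(y, y'). y < y'} snd") (rule wf_inv_image[OF wf], simp)

declare cord_mult.simps [simp del]

instantiation cord :: "{zero, one, plus, times}"
begin

definition zero_cord :: cord where "zero_cord = (LEAST x. True)"
definition one_cord :: cord where "one_cord = (LEAST x. 0 < (x :: cord))"
definition plus_cord :: "cord \<Rightarrow> cord \<Rightarrow> cord" where "plus_cord = cord_add"
definition times_cord :: "cord \<Rightarrow> cord \<Rightarrow> cord" where "times_cord = cord_mult"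

instance ..

end

primrec cord_of_nat :: "nat \<Rightarrow> cord" where
  "cord_of_nat 0 = 0"
| "cord_of_nat (Suc n) = cord_of_nat n + 1"

definition omega :: cord where
  "omega = (SUP n. cord_of_nat n)"

text \<open>\<open>omega_pow x\<close> is \<open>omega\<close> to the power \<open>x\<close>.\<close>

function omega_pow :: "cord \<Rightarrow> cord" where
  "omega_pow x = Sup (insert 1 ((\<lambda>z. omega_pow z * omega) ` {..<x}))"
  by pat_completeness auto
termination by (relation "{(y, y'). y < y'}") (rule wf, simp)

declare omega_pow.simps [simp del]

definition limit_cord :: "cord \<Rightarrow> bool" where
  "limit_cord x \<longleftrightarrow> x \<noteq> 0 \<and> (\<nexists>y. x = y + 1)"

text \<open>The following derives the usual transfinite recursion equations (\<open>cord_add_0\<close>, \<open>cord_add_Suc\<close>,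
  \<open>cord_add_limit\<close> and the analogues for \<open>*\<close> and \<open>omega_pow\<close>) from the above definitions.\<close>

lemma cord_Sup_upper: "countable X \<Longrightarrow> x \<in> X \<Longrightarrow> x \<le> Sup (X :: cord set)"
  by (simp add: cSup_upper countable_bdd_above_cord)

lemma zero_cord_le [simp]: "0 \<le> (x :: cord)"
  unfolding zero_cord_def by (rule Least_le) simp

lemma Sup_cord_least: "(\<And>x. x \<in> X \<Longrightarrow> x \<le> z) \<Longrightarrow> Sup X \<le> (z :: cord)"
  unfolding Sup_cord_def by (rule Least_le) blast

lemma ex_gt_cord: "\<exists>y. x < (y :: cord)"
proof (rule ccontr)
  assume "\<nexists>y. x < y"
  then have "UNIV = insert x {..<x}" by (auto simp: not_less le_less)
  moreover have "countable (insert x {..<x})" by (simp add: countable_lessThan_cord)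
  ultimately show False using uncountable_cord by simp
qed

lemma le_cord_add: "x \<le> x + (y :: cord)"
  unfolding plus_cord_def cord_add.simps[of x y]
  by (rule cord_Sup_upper) (simp_all add: countable_lessThan_cord)

lemma cord_add_strict: assumes "z < y" shows "x + z < x + (y :: cord)"
proof -
  have "x + z < (LEAST c. x + z < c)" by (rule LeastI_ex[OF ex_gt_cord])
  also have "\<dots> \<le> x + y"
    unfolding plus_cord_def cord_add.simps[of x y]
    by (rule cord_Sup_upper) (use assms in \<open>simp_all add: countable_lessThan_cord\<close>)
  finally show ?thesis .
qed

lemma cord_add_least:
  assumes "x \<le> c" "\<And>z. z < y \<Longrightarrow> x + z < c" shows "x + y \<le> (c :: cord)"
  unfolding plus_cord_def cord_add.simps[of x y]
  by (rule Sup_cord_least) (use assms in \<open>auto simp: plus_cord_def intro!: Least_le\<close>)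

lemma cord_add_0: "x + 0 = (x :: cord)"
  by (rule antisym[OF cord_add_least le_cord_add]) (auto simp: not_le[symmetric])

lemma less_one_cord: "z < (1 :: cord) \<longleftrightarrow> z = 0"
proof
  show "z = 0" if "z < 1"
    using not_less_Least[OF that[unfolded one_cord_def]] by (simp add: not_less antisym)
  have "0 < (1 :: cord)" unfolding one_cord_def by (rule LeastI_ex[OF ex_gt_cord])
  then show "z < 1" if "z = 0" using that by simp
qed

lemma cord_less_add_1: "x < x + (1 :: cord)"
  using cord_add_strict[of 0 1 x] by (simp add: cord_add_0 less_one_cord)

lemma cord_add_1_le: "x < c \<Longrightarrow> x + 1 \<le> (c :: cord)"
  by (rule cord_add_least) (auto simp: cord_add_0 less_one_cord)

lemma less_add_1_cord: "z < x + 1 \<longleftrightarrow> z \<le> (x :: cord)"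
  using cord_less_add_1[of x] cord_add_1_le[of x z] by (metis le_less_trans not_less)

lemma cord_add_Suc: "x + (y + 1) = (x + y) + (1 :: cord)"
proof (rule antisym)
  show "x + (y + 1) \<le> (x + y) + 1"
  proof (rule cord_add_least)
    show "x \<le> x + y + 1" using le_cord_add order_trans by blast
    fix z assume "z < y + 1"
    then have "x + z \<le> x + y"
      using cord_add_strict[of z y x] by (auto simp: less_add_1_cord le_less)
    then show "x + z < x + y + 1" by (simp add: less_add_1_cord)
  qed
  show "x + y + 1 \<le> x + (y + 1)"
    by (intro cord_add_1_le cord_add_strict cord_less_add_1)
qed

lemma cord_add_limit:
  assumes "limit_cord l" shows "x + l = (SUP z\<in>{..<l}. x + z)"
proof (rule antisym)
  have S: "x + z \<le> (SUP z\<in>{..<l}. x + z)" if "z < l" for z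
    by (rule cord_Sup_upper) (use that in \<open>simp_all add: countable_lessThan_cord\<close>)
  have l: "z + 1 < l" if "z < l" for z
    using that assms cord_add_1_le[of z l] by (auto simp: limit_cord_def le_less)
  have "0 < l" using assms by (simp add: limit_cord_def less_le)
  show "x + l \<le> (SUP z\<in>{..<l}. x + z)"
  proof (rule cord_add_least)
    show "x \<le> (SUP z\<in>{..<l}. x + z)" using S[OF \<open>0 < l\<close>] by (simp add: cord_add_0)
    show "x + z < (SUP z\<in>{..<l}. x + z)" if "z < l" for z
      using S[OF l[OF that]] cord_add_strict[OF cord_less_add_1[of z], of x] by simp
  qed
  show "(SUP z\<in>{..<l}. x + z) \<le> x + l"
    by (rule Sup_cord_least) (auto intro: less_imp_le cord_add_strict)
qed

lemma cord_add_mono: assumes "x \<le> x'" shows "x + y \<le> x' + (y :: cord)"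
proof (induction y rule: less_induct)
  case (less y)
  show ?case
  proof (rule cord_add_least)
    show "x \<le> x' + y" using assms le_cord_add order_trans by blast
    show "x + z < x' + y" if "z < y" for z
      using less[OF that] cord_add_strict[OF that, of x'] by simp
  qed
qed

lemma cord_mult_upper: "z < y \<Longrightarrow> x * z + x \<le> x * (y :: cord)"
  unfolding times_cord_def plus_cord_def cord_mult.simps[of x y]
  by (rule cord_Sup_upper) (simp_all add: countable_lessThan_cord)

lemma cord_mult_least: "(\<And>z. z < y \<Longrightarrow> x * z + x \<le> c) \<Longrightarrow> x * y \<le> (c :: cord)"
  unfolding times_cord_def plus_cord_def cord_mult.simps[of x y]
  by (rule Sup_cord_least) auto

lemma cord_mult_0: "x * 0 = (0 :: cord)"
  by (rule antisym[OF cord_mult_least]) (auto simp: not_le[symmetric])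

lemma cord_mult_mono: "y \<le> y' \<Longrightarrow> x * y \<le> x * (y' :: cord)"
  by (rule cord_mult_least) (meson cord_mult_upper less_le_trans)

lemma cord_mult_Suc: "x * (y + 1) = x * y + (x :: cord)"
  by (rule antisym)
     (auto intro!: cord_mult_least cord_add_mono cord_mult_mono cord_mult_upper cord_less_add_1
       simp: less_add_1_cord)

lemma cord_mult_limit: "limit_cord l \<Longrightarrow> x * l = (SUP z\<in>{..<l}. x * z)"
proof (rule antisym)
  assume lim: "limit_cord l"
  have l: "z + 1 < l" if "z < l" for z
    using that lim cord_add_1_le[of z l] by (auto simp: limit_cord_def le_less)
  have S: "x * z \<le> (SUP z\<in>{..<l}. x * z)" if "z < l" for z
    by (rule cord_Sup_upper) (use that in \<open>simp_all add: countable_lessThan_cord\<close>)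
  show "x * l \<le> (SUP z\<in>{..<l}. x * z)"
    by (rule cord_mult_least) (use S[OF l] in \<open>simp add: cord_mult_Suc\<close>)
  show "(SUP z\<in>{..<l}. x * z) \<le> x * l"
    by (rule Sup_cord_least) (auto intro: cord_mult_mono less_imp_le)
qed

lemma cord_mult_mono1: assumes "x \<le> x'" shows "x * y \<le> x' * (y :: cord)"
proof (induction y rule: less_induct)
  case (less y)
  show ?case
  proof (rule cord_mult_least)
    fix z assume z: "z < y"
    have "x * z + x \<le> x' * z + x" by (rule cord_add_mono[OF less[OF z]])
    also have "\<dots> \<le> x' * z + x'" using assms cord_add_strict[of x x' "x' * z"] by (auto simp: le_less)
    also have "\<dots> \<le> x' * y" by (rule cord_mult_upper[OF z])
    finally show "x * z + x \<le> x' * y" .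
  qed
qed

lemma omega_pow_upper: "z < x \<Longrightarrow> omega_pow z * omega \<le> omega_pow x" "1 \<le> omega_pow x"
  unfolding omega_pow.simps[of x]
  by (rule cord_Sup_upper; simp add: countable_lessThan_cord)+

lemma omega_pow_least: "1 \<le> c \<Longrightarrow> (\<And>z. z < x \<Longrightarrow> omega_pow z * omega \<le> c) \<Longrightarrow> omega_pow x \<le> c"
  unfolding omega_pow.simps[of x] by (rule Sup_cord_least) auto

lemma omega_pow_0: "omega_pow 0 = 1"
  by (rule antisym[OF omega_pow_least omega_pow_upper(2)]) (auto simp: not_le[symmetric])

lemma cord_0_add: "0 + y = (y :: cord)"
proof (induction y rule: less_induct)
  case (less y)
  have "y \<le> 0 + y" by (metis cord_add_strict less less_irrefl not_less)
  moreover have "0 + y \<le> y" by (rule cord_add_least) (use less in auto)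
  ultimately show ?case by simp
qed

lemma one_le_omega: "1 \<le> omega"
proof -
  have "cord_of_nat (Suc 0) \<le> omega"
    unfolding omega_def by (rule cord_Sup_upper) (simp_all del: cord_of_nat.simps)
  then show ?thesis by (simp add: cord_0_add)
qed

lemma omega_pow_mono: "x \<le> y \<Longrightarrow> omega_pow x \<le> omega_pow y"
  by (rule omega_pow_least) (auto intro: omega_pow_upper)

lemma omega_pow_Suc: "omega_pow (x + 1) = omega_pow x * omega"
proof (rule antisym)
  have "omega_pow x * 1 = omega_pow x"
    using cord_mult_Suc[of "omega_pow x" 0] by (simp add: cord_mult_0 cord_0_add)
  then have "1 \<le> omega_pow x * omega"
    by (metis cord_mult_mono omega_pow_upper(2) one_le_omega order_trans)
  then show "omega_pow (x + 1) \<le> omega_pow x * omega"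
    by (rule omega_pow_least) (auto simp: less_add_1_cord intro!: cord_mult_mono1 omega_pow_mono)
  show "omega_pow x * omega \<le> omega_pow (x + 1)"
    by (rule omega_pow_upper) (rule cord_less_add_1)
qed

lemma omega_pow_limit: assumes lim: "limit_cord l" shows "omega_pow l = (SUP z\<in>{..<l}. omega_pow z)"
proof (rule antisym)
  have l: "z + 1 < l" if "z < l" for z
    using that lim cord_add_1_le[of z l] by (auto simp: limit_cord_def le_less)
  have "0 < l" using lim by (simp add: limit_cord_def less_le)
  have S: "omega_pow z \<le> (SUP z\<in>{..<l}. omega_pow z)" if "z < l" for z
    by (rule cord_Sup_upper) (use that in \<open>simp_all add: countable_lessThan_cord\<close>)
  show "omega_pow l \<le> (SUP z\<in>{..<l}. omega_pow z)"
    by (rule omega_pow_least)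
       (use S[OF \<open>0 < l\<close>] S[OF l] in \<open>simp_all add: omega_pow_0 omega_pow_Suc\<close>)
  show "(SUP z\<in>{..<l}. omega_pow z) \<le> omega_pow l"
    by (rule Sup_cord_least) (auto intro: omega_pow_mono less_imp_le)
qed

text \<open>The value of \<open>omega_pow a\<^sub>0 * p\<^sub>0 + \<dots> + omega_pow a\<^sub>m * p\<^sub>m\<close> for
  the list \<open>[(a\<^sub>0, p\<^sub>0), \<dots>, (a\<^sub>m, p\<^sub>m)]\<close>.\<close>

definition cantor_sum :: "(cord \<times> nat) list \<Rightarrow> cord" where
  "cantor_sum cs = foldr (\<lambda>(a, p) x. omega_pow a * cord_of_nat p + x) cs 0"


section \<open>Schreier families\<close>

text \<open>Positions and indices start with 1; sequences are functions on \<^typ>\<open>nat\<close> whose value at 0 is irrelevant.\<close>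

text \<open>A choice, for every countable limit ordinal, of a strictly increasing sequence of successor
  ordinals that converges to it.\<close>

definition fundamental_sequences :: "(cord \<Rightarrow> nat \<Rightarrow> cord) \<Rightarrow> bool" where
  "fundamental_sequences fs \<longleftrightarrow>
    (\<forall>l. limit_cord l \<longrightarrow>
      (\<forall>n\<ge>1. \<exists>y. fs l n = y + 1) \<and>
      strict_mono_on {1..} (fs l) \<and>
      (SUP n\<in>{1..}. fs l n) = l)"

text \<open>Such a choice exists, so assuming one is not a restriction.\<close>

lemma ex_fundamental_sequences: "\<exists>fs. fundamental_sequences fs"
proof -
  have "\<exists>f :: nat \<Rightarrow> cord. (\<forall>n\<ge>1. \<exists>y. f n = y + 1) \<and> strict_mono_on {1..} f \<and> (SUP n\<in>{1..}. f n) = l"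
    if lim: "limit_cord l" for l
  proof -
    have l: "z + 1 < l" if "z < l" for z
      using that lim cord_add_1_le[of z l] by (auto simp: limit_cord_def le_less)
    have l0: "0 < l" using lim by (simp add: limit_cord_def less_le)
    define e where "e = from_nat_into {..<l}"
    have e: "e n < l" for n
      using from_nat_into[of "{..<l}" n] l0 unfolding e_def by blast
    define g where "g = rec_nat (0 + 1) (\<lambda>n x. max x (e n) + 1)"
    have g0: "g 0 = 0 + 1" and gS: "g (Suc n) = max (g n) (e n) + 1" for n
      by (simp_all add: g_def)
    have "\<exists>y. g n = y + 1" for n by (cases n) (auto simp: g0 gS)
    moreover have "g n < g (Suc n)" for n
      unfolding gS by (rule le_less_trans[OF max.cobounded1 cord_less_add_1])
    then have mono: "strict_mono g" by (simp add: strict_mono_Suc_iff)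
    moreover have gl: "g n < l" for n
      by (induction n) (auto simp: g0 gS l l0 e)
    moreover have "(SUP n\<in>{1..}. g n) = l"
    proof (rule antisym)
      show "(SUP n\<in>{1..}. g n) \<le> l"
        by (rule Sup_cord_least) (use gl in \<open>auto intro: less_imp_le\<close>)
      show "l \<le> (SUP n\<in>{1..}. g n)"
      proof (rule ccontr)
        assume "\<not> l \<le> (SUP n\<in>{1..}. g n)"
        then have "(SUP n\<in>{1..}. g n) \<in> {..<l}" by (simp add: not_le)
        then obtain m where m: "e m = (SUP n\<in>{1..}. g n)"
          unfolding e_def using from_nat_into_surj[OF countable_lessThan_cord] by blast
        have "e m < g (Suc m)"
          unfolding gS by (rule le_less_trans[OF max.cobounded2 cord_less_add_1])
        also have "g (Suc m) \<le> (SUP n\<in>{1..}. g n)" by (rule cord_Sup_upper) auto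
        finally show False using m by simp
      qed
    qed
    ultimately have "(\<forall>n\<ge>1. \<exists>y. g n = y + 1) \<and> strict_mono_on {1..} g \<and> (SUP n\<in>{1..}. g n) = l"
      using monotone_on_subset[OF mono, of "{1..}"] by blast
    then show ?thesis by blast
  qed
  then show ?thesis unfolding fundamental_sequences_def by metis
qed

definition set_less :: "nat set \<Rightarrow> nat set \<Rightarrow> bool" where
  "set_less s t \<longleftrightarrow> Max s < Min t"

text \<open>The unions \<open>t\<^sub>1 \<union> \<dots> \<union> t\<^sub>p\<close> of \<open>p\<close> successive members \<open>t\<^sub>1 < \<dots> < t\<^sub>p\<close> of a family.\<close>

definition successive_unions :: "nat set set \<Rightarrow> nat \<Rightarrow> nat set set" where
  "successive_unions F p =
    {\<Union> (set ts) | ts. length ts = p \<and> set ts \<subseteq> F \<and> sorted_wrt set_less ts}"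

lemma successive_unions_mono [mono]:
  assumes "\<And>t. P t \<longrightarrow> Q t"
  shows "s \<in> successive_unions {t. P t} p \<longrightarrow> s \<in> successive_unions {t. Q t} p"
  using assms unfolding successive_unions_def by blast

text \<open>In \<open>sum\<close>, \<open>cs = (\<alpha>, p) # cs'\<close> lists the exponents and coefficients of the Cantor normal
  form of \<open>\<xi>\<close>, and \<open>ss\<close> is the list \<open>s\<^sub>0, s\<^sub>1, \<dots>, s\<^sub>m\<close>, which is decreasing. In \<open>Suc\<close>, \<open>\<zeta> = 0\<close>
  is excluded because that case is \<open>one\<close>. In \<open>omega_pow_Suc\<close>, the number of blocks is the minimum of
  the first block, which is \<open>Min s\<close>.\<close>

inductive in_schreier :: "(cord \<Rightarrow> nat \<Rightarrow> cord) \<Rightarrow> cord \<Rightarrow> nat set \<Rightarrow> bool"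
  for fs :: "cord \<Rightarrow> nat \<Rightarrow> cord"
where
  zero: "in_schreier fs 0 {}"
| one: "n \<ge> 1 \<Longrightarrow> in_schreier fs 1 {n}"
| Suc: "in_schreier fs (\<zeta> + 1) ({n} \<union> s)"
    if "\<zeta> \<ge> 1" "n \<ge> 1" "in_schreier fs \<zeta> s" "set_less {n} s"
| omega_pow_Suc: "in_schreier fs (omega_pow (\<beta> + 1)) s"
    if "s \<noteq> {}" "s \<in> successive_unions {t. in_schreier fs (omega_pow \<beta>) t} (Min s)"
| omega_pow_limit: "in_schreier fs (omega_pow l) s"
    if "limit_cord l" "s \<noteq> {}" "in_schreier fs (omega_pow (fs l (Min s))) s"
| sum: "in_schreier fs \<xi> (\<Union> (set ss))"
    if "limit_cord \<xi>"
      "cs = (\<alpha>, p) # cs'"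
      "\<xi> = cantor_sum cs"
      "omega_pow \<alpha> < \<xi>" "\<xi> < omega_pow (\<alpha> + 1)"
      "sorted_wrt (>) (map fst cs)"
      "\<forall>(a, q) \<in> set cs. a > 0 \<and> q \<ge> 1"
      "length ss = length cs"
      "\<forall>i < length cs.
        ss ! i \<in> successive_unions {t. in_schreier fs (omega_pow (fst (cs ! i))) t} (snd (cs ! i))"
      "sorted_wrt (\<lambda>s t. set_less t s) ss"

definition schreier :: "(cord \<Rightarrow> nat \<Rightarrow> cord) \<Rightarrow> cord \<Rightarrow> nat set set" where
  "schreier fs \<xi> = {s. in_schreier fs \<xi> s}"


section \<open>Located words\<close>

text \<open>Words are partial functions on the positions \<open>1, 2, \<dots>\<close>. The alphabet is given by an
  enumeration \<open>\<alpha> 1, \<alpha> 2, \<dots>\<close> and the variable is a further letter \<open>\<upsilon>\<close>.\<close>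

type_synonym 'a word = "nat \<rightharpoonup> 'a"

definition words :: "(nat \<Rightarrow> 'a) \<Rightarrow> (nat \<Rightarrow> nat) \<Rightarrow> 'a word set" where
  "words \<alpha> k = {w. finite (dom w) \<and> dom w \<noteq> {} \<and> dom w \<subseteq> {1..} \<and>
    (\<forall>n\<in>dom w. the (w n) \<in> \<alpha> ` {1..k n})}"

definition var_words :: "(nat \<Rightarrow> 'a) \<Rightarrow> (nat \<Rightarrow> nat) \<Rightarrow> 'a \<Rightarrow> 'a word set" where
  "var_words \<alpha> k \<upsilon> = {w. finite (dom w) \<and> dom w \<noteq> {} \<and> dom w \<subseteq> {1..} \<and>
    (\<forall>n\<in>dom w. the (w n) \<in> insert \<upsilon> (\<alpha> ` {1..k n})) \<and> \<upsilon> \<in> ran w}"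

definition word_less :: "'a word \<Rightarrow> 'a word \<Rightarrow> bool" where
  "word_less w u \<longleftrightarrow> Max (dom w) < Min (dom u)"

text \<open>\<open>star_list [w\<^sub>1, \<dots>, w\<^sub>l]\<close> is \<open>w\<^sub>1 \<star> \<dots> \<star> w\<^sub>l\<close>; it is only used for words with
  \<open>w\<^sub>1 < \<dots> < w\<^sub>l\<close>, whose domains are disjoint.\<close>

definition star_list :: "'a word list \<Rightarrow> 'a word" where
  "star_list ws = foldr (++) ws Map.empty"

definition subst_word :: "(nat \<Rightarrow> 'a) \<Rightarrow> (nat \<Rightarrow> nat) \<Rightarrow> 'a \<Rightarrow> nat \<Rightarrow> 'a word \<Rightarrow> 'a word" where
  "subst_word \<alpha> k \<upsilon> p w =
    (if p = 0 then w
     else (\<lambda>n. map_option (\<lambda>x. if x = \<upsilon> then \<alpha> (min p (k n)) else x) (w n)))"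

definition var_word_seqs :: "(nat \<Rightarrow> 'a) \<Rightarrow> (nat \<Rightarrow> nat) \<Rightarrow> 'a \<Rightarrow> (nat \<Rightarrow> 'a word) set" where
  "var_word_seqs \<alpha> k \<upsilon> =
    {ws. \<forall>n\<ge>1. ws n \<in> var_words \<alpha> k \<upsilon> \<and> word_less (ws n) (ws (n + 1))}"

text \<open>\<open>nps\<close> is the list of the pairs \<open>(n\<^sub>1, p\<^sub>1), \<dots>, (n\<^sub>\<lambda>, p\<^sub>\<lambda>)\<close>.\<close>

definition EV_words :: "(nat \<Rightarrow> 'a) \<Rightarrow> (nat \<Rightarrow> nat) \<Rightarrow> 'a \<Rightarrow> (nat \<Rightarrow> 'a word) \<Rightarrow> 'a word set" where
  "EV_words \<alpha> k \<upsilon> ws =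
    {star_list (map (\<lambda>(n, p). subst_word \<alpha> k \<upsilon> p (ws n)) nps) | nps.
      nps \<noteq> [] \<and> sorted_wrt (<) (map fst nps) \<and>
      (\<forall>(n, p) \<in> set nps. n \<ge> 1 \<and> p \<le> k n) \<and> (\<exists>(n, p) \<in> set nps. p = 0)}"

definition E_words :: "(nat \<Rightarrow> 'a) \<Rightarrow> (nat \<Rightarrow> nat) \<Rightarrow> 'a \<Rightarrow> (nat \<Rightarrow> 'a word) \<Rightarrow> 'a word set" where
  "E_words \<alpha> k \<upsilon> ws =
    {star_list (map (\<lambda>(n, p). subst_word \<alpha> k \<upsilon> p (ws n)) nps) | nps.
      nps \<noteq> [] \<and> sorted_wrt (<) (map fst nps) \<and>
      (\<forall>(n, p) \<in> set nps. n \<ge> 1 \<and> 1 \<le> p \<and> p \<le> k n)}"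

definition extraction ::
    "(nat \<Rightarrow> 'a) \<Rightarrow> (nat \<Rightarrow> nat) \<Rightarrow> 'a \<Rightarrow> (nat \<Rightarrow> 'a word) \<Rightarrow> (nat \<Rightarrow> 'a word) \<Rightarrow> bool" where
  "extraction \<alpha> k \<upsilon> us ws \<longleftrightarrow> us \<in> var_word_seqs \<alpha> k \<upsilon> \<and> (\<forall>n\<ge>1. us n \<in> EV_words \<alpha> k \<upsilon> ws)"

definition word_tuples :: "(nat \<Rightarrow> 'a) \<Rightarrow> (nat \<Rightarrow> nat) \<Rightarrow> 'a word list set" where
  "word_tuples \<alpha> k = {ws. sorted_wrt word_less ws \<and> set ws \<subseteq> words \<alpha> k}"

definition E_tuples ::
    "(nat \<Rightarrow> 'a) \<Rightarrow> (nat \<Rightarrow> nat) \<Rightarrow> 'a \<Rightarrow> (nat \<Rightarrow> 'a word) \<Rightarrow> 'a word list set" where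
  "E_tuples \<alpha> k \<upsilon> us = {ws \<in> word_tuples \<alpha> k. set ws \<subseteq> E_words \<alpha> k \<upsilon> us}"

definition schreier_tuples ::
    "(cord \<Rightarrow> nat \<Rightarrow> cord) \<Rightarrow> cord \<Rightarrow> (nat \<Rightarrow> 'a) \<Rightarrow> (nat \<Rightarrow> nat) \<Rightarrow> 'a word list set" where
  "schreier_tuples fs \<xi> \<alpha> k =
    {ws \<in> word_tuples \<alpha> k. (\<lambda>w. Min (dom w)) ` set ws \<in> schreier fs \<xi>}"

end

theory Submission
  imports Defs "HOL-Analysis.Function_Topology"
begin

text \<open>A word over the indices of \<open>ws\<close>, with letter 0 for the variable, encodes an element of
  \<open>E(ws)\<close> or \<open>EV(ws)\<close>. On the semigroup of these index words there are ultrafilters \<open>U = U * U\<close>,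
  living on the words without variable, and \<open>V\<close>, living on the variable words, such that every
  substitution maps \<open>V\<close> to \<open>U\<close>; they come from a minimal idempotent as in the ultrafilter proof of
  Carlson's theorem. For a family \<open>F\<close> of tuples, let \<open>s\<close> be accepted if \<open>s \<in> F\<close> or if \<open>U\<close>-almost
  every one-word extension of \<open>s\<close> is accepted. If the empty tuple is not accepted, a Galvin-Glazer
  construction with \<open>V\<close> gives an extraction none of whose tuples is in \<open>F\<close>. The empty tuple cannot
  be accepted both for \<open>G\<close> and for its complement in \<open>L\<^sup>\<xi>\<close>: following both acceptances along a
  common branch would give two members of \<open>L\<^sup>\<xi>\<close>, one a proper beginning of the other, whereas no
  member of the Schreier family \<open>A\<^sub>\<xi>\<close> is a proper initial segment of another.\<close>

section \<open>Idempotents in compact right topological semigroups\<close>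

text \<open>Ultrafilters will be points of \<open>('s \<Rightarrow> bool) \<Rightarrow> bool\<close>
  with the product topology. The compactness arguments below need this space Hausdorff, so that
  compact sets are closed and fibres of continuous maps over a point are closed.\<close>

instance "fun" :: (type, t2_space) t2_space
proof
  fix f g :: "'a \<Rightarrow> 'b"
  assume "f \<noteq> g"
  then obtain i where i: "f i \<noteq> g i" by (auto simp: fun_eq_iff)
  obtain A B where AB: "open A" "open B" "f i \<in> A" "g i \<in> B" "A \<inter> B = {}"
    using hausdorff[OF i] by blast
  have op: "open ((\<lambda>h. h i) -` S)" if "open S" for S :: "'b set"
    using that by (rule open_vimage) simp
  show "\<exists>S T. open S \<and> open T \<and> f \<in> S \<and> g \<in> T \<and> S \<inter> T = {}"
    using AB op[of A] op[of B]
    by (intro exI[of _ "(\<lambda>h. h i) -` A"] exI[of _ "(\<lambda>h. h i) -` B"]) auto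
qed

lemma compact_UNIV_fun: "compact (UNIV :: ('a \<Rightarrow> 'b::{topological_space,finite}) set)"
proof -
  have "compact (UNIV :: 'b set)" by (simp add: finite_imp_compact)
  then have "compact_space (euclidean :: 'b topology)"
    by (simp add: compact_space_def)
  then have "compact_space (product_topology (\<lambda>_::'a. euclidean :: 'b topology) UNIV)"
    by (simp add: compact_space_product_topology)
  then show ?thesis
    by (simp add: compact_space_def euclidean_product_topology)
qed

text \<open>Zorn's lemma for reverse inclusion, with compactness keeping the intersection of a chain
  nonempty. The property \<open>P\<close> is left open because it is used once for subsemigroups and
  once for left ideals.\<close>

lemma minimal_compact_subset:
  fixes X :: "'b::t2_space set"
  assumes X: "compact X" "X \<noteq> {}" "P X"
    and Inter: "\<And>C. C \<noteq> {} \<Longrightarrow> (\<And>S. S \<in> C \<Longrightarrow> P S) \<Longrightarrow> P (\<Inter>C)"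
  obtains M where "M \<subseteq> X" "M \<noteq> {}" "compact M" "P M"
    "\<And>N. N \<subseteq> M \<Longrightarrow> N \<noteq> {} \<Longrightarrow> compact N \<Longrightarrow> P N \<Longrightarrow> N = M"
proof -
  define A where "A = {M. M \<subseteq> X \<and> M \<noteq> {} \<and> compact M \<and> P M}"
  have XA: "X \<in> A" using X by (simp add: A_def)
  have "\<exists>M\<in>A. \<forall>N\<in>A. M \<supseteq> N \<longrightarrow> N = M"
  proof (rule predicate_Zorn)
    show "partial_order_on A (relation_of (\<supseteq>) A)"
      by (rule partial_order_on_relation_ofI) auto
    fix C assume C: "C \<in> Chains (relation_of (\<supseteq>) A)"
    then have CA: "C \<subseteq> A" and ch: "\<And>S T. S \<in> C \<Longrightarrow> T \<in> C \<Longrightarrow> S \<subseteq> T \<or> T \<subseteq> S"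
      by (auto simp: Chains_def relation_of_def)
    show "\<exists>M\<in>A. \<forall>S\<in>C. S \<supseteq> M"
    proof (cases "C = {}")
      case True then show ?thesis using XA by blast
    next
      case False
      have clo: "closed S" if "S \<in> C" for S
        using that CA compact_imp_closed by (auto simp: A_def)
      \<comment> \<open>A finite part of a chain has a smallest member; this yields the finite
        intersection property.\<close>
      have fin: "\<exists>T\<in>C. T \<subseteq> \<Inter>D" if "finite D" "D \<noteq> {}" "D \<subseteq> C" for D
        using that
      proof (induction D rule: finite_ne_induct)
        case (singleton x) then show ?case by auto
      next
        case (insert x D)
        then obtain T where T: "T \<in> C" "T \<subseteq> \<Inter>D" by auto
        then show ?case using ch[of x T] insert.prems by auto
      qed
      obtain S0 where S0: "S0 \<in> C" using False by blast
      have "X \<inter> \<Inter>C \<noteq> {}"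
      proof (rule compact_imp_fip)
        show "compact X" by (rule X(1))
        show "closed S" if "S \<in> C" for S using that by (rule clo)
        show "X \<inter> \<Inter>D \<noteq> {}" if D: "finite D" "D \<subseteq> C" for D
        proof (cases "D = {}")
          case True then show ?thesis using X by simp
        next
          case False
          then obtain T where T: "T \<in> C" "T \<subseteq> \<Inter>D" using fin[OF D(1) False D(2)] by auto
          then have "T \<subseteq> X" "T \<noteq> {}" using CA by (auto simp: A_def)
          then show ?thesis using T by blast
        qed
      qed
      moreover have "compact (\<Inter>C)"
      proof -
        have "S0 \<inter> \<Inter>C = \<Inter>C" using S0 by blast
        moreover have "compact S0" using S0 CA by (auto simp: A_def)
        moreover have "closed (\<Inter>C)" using clo by blast
        ultimately show ?thesis by (metis compact_Int_closed)
      qed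
      moreover have "P (\<Inter>C)" using Inter[OF False] CA by (auto simp: A_def)
      ultimately have "\<Inter>C \<in> A" using S0 CA by (auto simp: A_def)
      then show ?thesis by blast
    qed
  qed
  then obtain M where "M \<in> A" and min: "\<And>N. N \<in> A \<Longrightarrow> N \<subseteq> M \<Longrightarrow> N = M" by blast
  have M: "M \<subseteq> X" "M \<noteq> {}" "compact M" "P M" using \<open>M \<in> A\<close> by (simp_all add: A_def)
  show thesis
  proof (rule that[OF M])
    fix N assume N: "N \<subseteq> M" "N \<noteq> {}" "compact N" "P N"
    then have "N \<in> A" using M by (auto simp: A_def)
    then show "N = M" using N(1) by (rule min)
  qed
qed

text \<open>The Ellis-Numakura argument. In a minimal compact subsemigroup \<open>M\<close> with
  \<open>e\<close> in \<open>M\<close>, the set \<open>M e\<close> is again a compact subsemigroup,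
  hence all of \<open>M\<close>, so some \<open>p\<close> satisfies \<open>p e = e\<close>. The set
  of all such \<open>p\<close> is a compact subsemigroup too, hence all of \<open>M\<close>, and so
  it contains \<open>e\<close>.\<close>

lemma compact_semigroup_idempotent:
  fixes m :: "'b::t2_space \<Rightarrow> 'b \<Rightarrow> 'b"
  assumes assoc: "\<And>a b c. m (m a b) c = m a (m b c)"
    and cont: "\<And>q. continuous_on UNIV (\<lambda>p. m p q)"
    and X: "compact X" "X \<noteq> {}" "\<And>p q. p \<in> X \<Longrightarrow> q \<in> X \<Longrightarrow> m p q \<in> X"
  shows "\<exists>e\<in>X. m e e = e"
proof -
  obtain M where M: "M \<subseteq> X" "M \<noteq> {}" "compact M" "\<forall>p\<in>M. \<forall>q\<in>M. m p q \<in> M"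
    and min: "\<And>N. N \<subseteq> M \<Longrightarrow> N \<noteq> {} \<Longrightarrow> compact N \<Longrightarrow> \<forall>p\<in>N. \<forall>q\<in>N. m p q \<in> N \<Longrightarrow> N = M"
    by (rule minimal_compact_subset[of X "\<lambda>M. \<forall>p\<in>M. \<forall>q\<in>M. m p q \<in> M"]) (use X in auto)
  obtain e where e: "e \<in> M" using M by blast
  have "(\<lambda>p. m p e) ` M = M"
  proof (rule min)
    show "compact ((\<lambda>p. m p e) ` M)"
      by (rule compact_continuous_image[OF continuous_on_subset[OF cont] M(3)]) simp
    show "\<forall>p\<in>(\<lambda>p. m p e) ` M. \<forall>q\<in>(\<lambda>p. m p e) ` M. m p q \<in> (\<lambda>p. m p e) ` M"
      using M e by (auto simp: assoc[symmetric])
  qed (use M e in auto)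
  then obtain p where p: "p \<in> M" "m p e = e" using e by (metis (no_types, lifting) imageE)
  have "{p\<in>M. m p e = e} = M"
  proof (rule min)
    have "closed ((\<lambda>p. m p e) -` {e})"
      by (rule continuous_closed_vimage[OF closed_singleton])
         (use cont in \<open>simp add: continuous_on_eq_continuous_at\<close>)
    then have "compact (M \<inter> (\<lambda>p. m p e) -` {e})" using M by (simp add: compact_Int_closed)
    moreover have "{p\<in>M. m p e = e} = M \<inter> (\<lambda>p. m p e) -` {e}" by auto
    ultimately show "compact {p\<in>M. m p e = e}" by simp
    show "\<forall>p\<in>{p\<in>M. m p e = e}. \<forall>q\<in>{p\<in>M. m p e = e}. m p q \<in> {p\<in>M. m p e = e}"
      using M by (auto simp: assoc)
  qed (use p in auto)
  then show ?thesis using e M by blast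
qed

text \<open>Take an idempotent \<open>e\<close> in a minimal compact left ideal \<open>M\<close>. An
  idempotent \<open>f\<close> with \<open>f e = e f = f\<close> lies in \<open>M\<close>, so
  \<open>X f = M\<close> by minimality and \<open>e = r f\<close> for some \<open>r\<close>. Then
  \<open>e f = r f f = e\<close>, while \<open>e f = f\<close>.\<close>

lemma compact_semigroup_minimal_idempotent:
  fixes m :: "'b::t2_space \<Rightarrow> 'b \<Rightarrow> 'b"
  assumes assoc: "\<And>a b c. m (m a b) c = m a (m b c)"
    and cont: "\<And>q. continuous_on UNIV (\<lambda>p. m p q)"
    and X: "compact X" "X \<noteq> {}" "\<And>p q. p \<in> X \<Longrightarrow> q \<in> X \<Longrightarrow> m p q \<in> X"
  shows "\<exists>e\<in>X. m e e = e \<and> (\<forall>f\<in>X. m f f = f \<longrightarrow> m f e = f \<longrightarrow> m e f = f \<longrightarrow> f = e)"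
proof -
  obtain M where M: "M \<subseteq> X" "M \<noteq> {}" "compact M" "\<forall>p\<in>X. \<forall>q\<in>M. m p q \<in> M"
    and min: "\<And>N. N \<subseteq> M \<Longrightarrow> N \<noteq> {} \<Longrightarrow> compact N \<Longrightarrow> \<forall>p\<in>X. \<forall>q\<in>N. m p q \<in> N \<Longrightarrow> N = M"
    by (rule minimal_compact_subset[of X "\<lambda>M. \<forall>p\<in>X. \<forall>q\<in>M. m p q \<in> M"]) (use X in auto)
  have "\<exists>e\<in>M. m e e = e"
    by (rule compact_semigroup_idempotent[of m M, OF assoc cont M(3,2)]) (use M in auto)
  then obtain e where e: "e \<in> M" "m e e = e" by blast
  have "f = e" if f: "f \<in> X" "m f f = f" "m f e = f" "m e f = f" for f
  proof -
    have fM: "f \<in> M" using f e M by metis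
    have "(\<lambda>p. m p f) ` X = M"
    proof (rule min)
      show "compact ((\<lambda>p. m p f) ` X)"
        by (rule compact_continuous_image[OF continuous_on_subset[OF cont] X(1)]) simp
      show "\<forall>p\<in>X. \<forall>q\<in>(\<lambda>p. m p f) ` X. m p q \<in> (\<lambda>p. m p f) ` X"
        using X by (auto simp: assoc[symmetric])
    qed (use M X fM in auto)
    then obtain r where r: "e = m r f" using e by blast
    have "m e f = e" using assoc[of r f f] f r by simp
    then show ?thesis using f by simp
  qed
  then show ?thesis using e M by blast
qed

section \<open>Ultrafilters on a semigroup\<close>

text \<open>An ultrafilter read as the quantifier "for almost all", that is, as a Boolean
  homomorphism on predicates. In this form it is a point of a power of \<open>bool\<close>.\<close>

definition ultra :: "(('s \<Rightarrow> bool) \<Rightarrow> bool) \<Rightarrow> bool" where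
  "ultra p \<longleftrightarrow> p (\<lambda>_. True) \<and> (\<forall>A B. p (\<lambda>x. A x \<and> B x) \<longleftrightarrow> p A \<and> p B) \<and>
    (\<forall>A. p (\<lambda>x. \<not> A x) \<longleftrightarrow> \<not> p A)"

text \<open>With the quantifier of \<open>p\<close> outside, the value at \<open>A\<close> is a
  coordinate of \<open>p\<close>, so the product is continuous in its left factor.\<close>

definition ultra_prod ::
    "('s \<Rightarrow> 's \<Rightarrow> 's) \<Rightarrow> (('s \<Rightarrow> bool) \<Rightarrow> bool) \<Rightarrow> (('s \<Rightarrow> bool) \<Rightarrow> bool) \<Rightarrow> ('s \<Rightarrow> bool) \<Rightarrow> bool" where
  "ultra_prod f p q A \<longleftrightarrow> p (\<lambda>x. q (\<lambda>y. A (f x y)))"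

definition ultra_map :: "('s \<Rightarrow> 't) \<Rightarrow> (('s \<Rightarrow> bool) \<Rightarrow> bool) \<Rightarrow> ('t \<Rightarrow> bool) \<Rightarrow> bool" where
  "ultra_map g p A \<longleftrightarrow> p (\<lambda>x. A (g x))"

lemma ultra_conj: "ultra p \<Longrightarrow> p (\<lambda>x. A x \<and> B x) \<longleftrightarrow> p A \<and> p B"
  and ultra_not: "ultra p \<Longrightarrow> p (\<lambda>x. \<not> A x) \<longleftrightarrow> \<not> p A"
  and ultra_True: "ultra p \<Longrightarrow> p (\<lambda>_. True)"
  by (simp_all add: ultra_def)

lemma ultra_mono:
  assumes "ultra p" "p A" "\<And>x. A x \<Longrightarrow> B x"
  shows "p B"
proof -
  have "A = (\<lambda>x. A x \<and> B x)" using assms(3) by blast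
  then have "p (\<lambda>x. A x \<and> B x)" using assms(2) by simp
  then show ?thesis using assms(1) by (simp add: ultra_conj)
qed

lemma ultra_mp:
  assumes "ultra p" "p A" "p B" "\<And>x. A x \<Longrightarrow> B x \<Longrightarrow> C x"
  shows "p C"
proof -
  have "p (\<lambda>x. A x \<and> B x)" using assms by (simp add: ultra_conj)
  then show ?thesis by (rule ultra_mono[OF assms(1)]) (use assms(4) in blast)
qed

lemma ultra_ex: "ultra p \<Longrightarrow> p A \<Longrightarrow> \<exists>x. A x"
  using ultra_not[of p "\<lambda>_. True"] ultra_mono[of p A "\<lambda>_. False"] ultra_True[of p] by auto

lemma ultra_ball_finite:
  assumes "ultra p" "finite I" shows "p (\<lambda>x. \<forall>i\<in>I. A i x) \<longleftrightarrow> (\<forall>i\<in>I. p (A i))"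
  using assms(2) by induction (simp_all add: ultra_True[OF assms(1)] ultra_conj[OF assms(1)])

lemma ultra_ultra_prod: "ultra p \<Longrightarrow> ultra q \<Longrightarrow> ultra (ultra_prod f p q)"
  by (simp add: ultra_def ultra_prod_def)

lemma ultra_ultra_map: "ultra p \<Longrightarrow> ultra (ultra_map g p)"
  by (simp add: ultra_def ultra_map_def)

lemma ultra_map_prod:
  assumes "\<And>x y. g (f x y) = f' (g x) (g y)"
  shows "ultra_map g (ultra_prod f p q) = ultra_prod f' (ultra_map g p) (ultra_map g q)"
  by (rule ext) (simp add: ultra_map_def ultra_prod_def assms)

lemma ultra_prod_assoc:
  assumes "\<And>x y z. f (f x y) z = f x (f y z)"
  shows "ultra_prod f (ultra_prod f p q) r = ultra_prod f p (ultra_prod f q r)"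
  by (rule ext) (simp add: ultra_prod_def assms)

lemma continuous_on_ultra_prod: "continuous_on S (\<lambda>p. ultra_prod f p q)"
  unfolding ultra_prod_def
  by (rule continuous_on_coordinatewise_then_product) (rule continuous_on_subset[OF continuous_on_product_coordinates subset_UNIV])

text \<open>For \<open>B n\<close> the words with all positions above \<open>n\<close>, these are
  the ultrafilters at infinity. In a product of two of them almost all pairs have the second word
  beyond the first, so the total operation \<open>++\<close> can replace the partial operation on
  located words.\<close>

definition ultras :: "(nat \<Rightarrow> 's \<Rightarrow> bool) \<Rightarrow> (('s \<Rightarrow> bool) \<Rightarrow> bool) set" where
  "ultras B = {p. ultra p \<and> (\<forall>n. p (B n))}"

lemma open_coordinate: "open {p :: ('s \<Rightarrow> bool) \<Rightarrow> bool. p A}"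
  and closed_coordinate: "closed {p :: ('s \<Rightarrow> bool) \<Rightarrow> bool. p A}"
proof -
  have *: "{p :: ('s \<Rightarrow> bool) \<Rightarrow> bool. p A} = (\<lambda>p. p A) -` {True}" by auto
  have c: "continuous_on UNIV (\<lambda>p :: ('s \<Rightarrow> bool) \<Rightarrow> bool. p A)" by simp
  show "open {p :: ('s \<Rightarrow> bool) \<Rightarrow> bool. p A}"
    unfolding * by (rule open_vimage[OF _ c]) (simp add: open_discrete)
  show "closed {p :: ('s \<Rightarrow> bool) \<Rightarrow> bool. p A}"
    unfolding * by (rule closed_vimage[OF _ c]) simp
qed

text \<open>Each clause of \<open>ultra\<close> concerns finitely many coordinates, and coordinates
  are clopen because \<open>bool\<close> is discrete. So the set is closed in a compact
  space.\<close>

lemma compact_ultras: "compact (ultras B)"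
proof -
  have c: "closed {p :: ('s \<Rightarrow> bool) \<Rightarrow> bool. \<not> p A}" for A
    using open_coordinate[of A] by (simp add: closed_def Collect_neg_eq)
  have o: "open {p :: ('s \<Rightarrow> bool) \<Rightarrow> bool. \<not> p A}" for A
    using closed_coordinate[of A] by (simp add: closed_def Collect_neg_eq)
  have "closed (ultras B)"
    unfolding ultras_def ultra_def iff_conv_conj_imp
    by (intro closed_Collect_conj closed_Collect_all closed_Collect_imp open_Collect_conj
        closed_coordinate open_coordinate c o)
  then show ?thesis
    using compact_Int_closed[OF compact_UNIV_fun, of "ultras B"] by simp
qed

lemma ultras_nonempty:
  assumes "\<And>n. \<exists>x. B n x" and dec: "\<And>m n x. m \<le> n \<Longrightarrow> B n x \<Longrightarrow> B m x"
  shows "ultras B \<noteq> {}"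
proof -
  obtain x where x: "\<And>n. B n (x n)" using assms(1) by metis
  define C where "C n = {p. ultra p \<and> p (B n)}" for n
  have "UNIV \<inter> \<Inter>(range C) \<noteq> {}"
  proof (rule compact_imp_fip[OF compact_UNIV_fun])
    show "closed T" if "T \<in> range C" for T
    proof -
      from that obtain n where "T = C n" by (rule rangeE)
      then have "T = ultras (\<lambda>_. B n)" by (simp add: C_def ultras_def)
      then show ?thesis using compact_ultras compact_imp_closed by blast
    qed
    fix D assume D: "finite D" "D \<subseteq> range C"
    then obtain I where I: "finite I" "D = C ` I" by (meson finite_subset_image)
    \<comment> \<open>The witness for a finite subfamily is the principal ultrafilter at a point of
      the smallest \<open>B i\<close> involved; \<open>insert 0\<close> covers the empty
      subfamily.\<close>
    have "(\<lambda>A. A (x (Max (insert 0 I)))) \<in> C i" if "i \<in> I" for i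
      using that I dec[of i "Max (insert 0 I)"] x by (simp add: C_def ultra_def)
    then show "UNIV \<inter> \<Inter>D \<noteq> {}" using I by blast
  qed
  then show ?thesis by (auto simp: ultras_def C_def)
qed

section \<open>Index words\<close>

text \<open>Positions are indices of \<open>ws\<close>, and \<open>x i = Some p\<close> stands for
  the factor \<open>T_p(w_i)\<close>. The letter 0 is the variable because \<open>T_0\<close> leaves
  a word unchanged.\<close>

definition const_above :: "(nat \<Rightarrow> nat) \<Rightarrow> nat \<Rightarrow> nat word \<Rightarrow> bool" where
  "const_above k n x \<longleftrightarrow> finite (dom x) \<and> dom x \<noteq> {} \<and>
    (\<forall>i a. x i = Some a \<longrightarrow> n < i \<and> 1 \<le> a \<and> a \<le> k i)"

definition var_above :: "(nat \<Rightarrow> nat) \<Rightarrow> nat \<Rightarrow> nat word \<Rightarrow> bool" where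
  "var_above k n x \<longleftrightarrow> finite (dom x) \<and> 0 \<in> ran x \<and>
    (\<forall>i a. x i = Some a \<longrightarrow> n < i \<and> a \<le> k i)"

text \<open>The truncation at \<open>k i\<close> keeps letters admissible, so that one pair of
  ultrafilters can serve every \<open>p \<ge> 1\<close>.\<close>

definition index_subst :: "(nat \<Rightarrow> nat) \<Rightarrow> nat \<Rightarrow> nat word \<Rightarrow> nat word" where
  "index_subst k p x = (\<lambda>i. map_option (\<lambda>a. if a = 0 then min p (k i) else a) (x i))"

lemma const_above_antimono: "const_above k n x \<Longrightarrow> m \<le> n \<Longrightarrow> const_above k m x"
  by (fastforce simp: const_above_def)

lemma var_above_antimono: "var_above k n x \<Longrightarrow> m \<le> n \<Longrightarrow> var_above k m x"
  by (fastforce simp: var_above_def)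

lemma index_subst_add: "index_subst k p (x ++ y) = index_subst k p x ++ index_subst k p y"
  by (rule ext) (simp add: index_subst_def map_add_def split: option.split)

lemma index_subst_const: "const_above k n x \<Longrightarrow> index_subst k p x = x"
  by (rule ext) (auto simp: index_subst_def const_above_def map_option_case split: option.split)

lemma const_above_index_subst:
  assumes k: "\<And>i. i \<ge> 1 \<Longrightarrow> k i \<ge> 1" and "var_above k n x" "p \<ge> 1"
  shows "const_above k n (index_subst k p x)"
proof -
  have "dom (index_subst k p x) = dom x" by (auto simp: index_subst_def)
  moreover have "dom x \<noteq> {}" using assms(2) by (auto simp: var_above_def ran_def)
  moreover have "n < i \<and> 1 \<le> a \<and> a \<le> k i" if "index_subst k p x i = Some a" for i a
  proof -
    obtain b where b: "x i = Some b" "a = (if b = 0 then min p (k i) else b)"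
      using \<open>index_subst k p x i = Some a\<close> by (auto simp: index_subst_def)
    then have "n < i" "b \<le> k i" using assms(2) by (auto simp: var_above_def)
    then show ?thesis using b assms(3) k[of i] by auto
  qed
  ultimately show ?thesis using assms(2) by (simp add: const_above_def var_above_def)
qed

lemma const_above_nonempty:
  assumes k: "\<And>i. i \<ge> 1 \<Longrightarrow> k i \<ge> 1"
  shows "const_above k n [Suc n \<mapsto> 1]"
  using k[of "Suc n"] by (auto simp: const_above_def)

lemma var_above_nonempty: "var_above k n [Suc n \<mapsto> 0]"
  by (auto simp: var_above_def)

lemma const_above_add:
  assumes "const_above k n x" "const_above k n y" shows "const_above k n (x ++ y)"
proof -
  have "n < j \<and> 1 \<le> a \<and> a \<le> k j" if "(x ++ y) j = Some a" for j a
    using that assms unfolding map_add_Some_iff const_above_def by blast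
  then show ?thesis using assms by (simp add: const_above_def)
qed

lemma const_var_above_add:
  assumes "const_above k n x \<or> var_above k n x" "var_above k n y"
  shows "var_above k n (x ++ y)"
proof -
  obtain i where "y i = Some 0" using assms by (auto simp: var_above_def ran_def)
  then have "(x ++ y) i = Some 0" by simp
  then have "0 \<in> ran (x ++ y)" by (rule ranI)
  moreover have "n < j \<and> a \<le> k j" if "(x ++ y) j = Some a" for j a
    using that assms unfolding map_add_Some_iff const_above_def var_above_def by blast
  moreover have "finite (dom (x ++ y))" using assms by (auto simp: const_above_def var_above_def)
  ultimately show ?thesis by (simp add: var_above_def)
qed

text \<open>In \<open>x ++ y\<close> the letters of \<open>y\<close> overwrite those of
  \<open>x\<close>. The third assumption puts \<open>y\<close> beyond \<open>x\<close>, so the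
  variable of \<open>x\<close> survives.\<close>

lemma var_const_above_add:
  assumes "var_above k n x" "const_above k n y" "const_above k (Max (dom x)) y"
  shows "var_above k n (x ++ y)"
proof -
  obtain i where i: "x i = Some 0" using assms by (auto simp: var_above_def ran_def)
  then have "i \<le> Max (dom x)" using assms by (intro Max_ge) (auto simp: var_above_def)
  moreover have "Max (dom x) < i" if "y i = Some a" for a
    using that assms(3) unfolding const_above_def by blast
  ultimately have "y i = None" by (meson leD option.exhaust)
  then have "(x ++ y) i = Some 0" using i by (simp add: map_add_def)
  then have "0 \<in> ran (x ++ y)" by (rule ranI)
  moreover have "n < j \<and> a \<le> k j" if "(x ++ y) j = Some a" for j a
    using that assms unfolding map_add_Some_iff const_above_def var_above_def by blast
  moreover have "finite (dom (x ++ y))" using assms by (simp add: const_above_def var_above_def)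
  ultimately show ?thesis by (simp add: var_above_def)
qed

text \<open>Since \<open>q\<close> contains every \<open>B m\<close>, the bound \<open>m\<close>
  imposed on the second factor may depend on the first factor \<open>x\<close>.\<close>

lemma ultra_prod_in_ultras:
  assumes p: "p \<in> ultras A" and q: "q \<in> ultras B"
    and AB: "\<And>n x. A n x \<Longrightarrow> \<exists>m. \<forall>y. B n y \<longrightarrow> B m y \<longrightarrow> D n (f x y)"
  shows "ultra_prod f p q \<in> ultras D"
proof -
  have up: "ultra p" and uq: "ultra q" using p q by (simp_all add: ultras_def)
  have "ultra_prod f p q (D n)" for n
    unfolding ultra_prod_def
  proof (rule ultra_mono[OF up])
    show "p (A n)" using p by (simp add: ultras_def)
    fix x assume "A n x"
    from AB[OF this] obtain m where m: "\<forall>y. B n y \<longrightarrow> B m y \<longrightarrow> D n (f x y)" by (rule exE)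
    have "q (B n)" "q (B m)" using q by (simp_all add: ultras_def)
    then show "q (\<lambda>y. D n (f x y))" by (rule ultra_mp[OF uq]) (use m in simp)
  qed
  then show ?thesis using up uq by (simp add: ultras_def ultra_ultra_prod)
qed

text \<open>\<open>U\<close> is a minimal idempotent among the ultrafilters on constant words, and
  \<open>V\<close> an idempotent below \<open>U\<close> on variable words. A substitution is a
  homomorphism that fixes constant words, hence fixes \<open>U\<close>; it maps \<open>V\<close> to
  an idempotent on constant words below \<open>U\<close>, which equals \<open>U\<close> by
  minimality.\<close>

lemma variable_idempotent_pair:
  assumes k: "\<And>i. i \<ge> 1 \<Longrightarrow> k i \<ge> 1"
  obtains U V where "ultra U" "ultra V" "ultra_prod (++) U U = U"
    "\<And>n. V (var_above k n)" "\<And>p. p \<ge> 1 \<Longrightarrow> ultra_map (index_subst k p) V = U"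
proof -
  let ?C = "ultras (const_above k)" and ?W = "ultras (var_above k)"
  let ?m = "ultra_prod ((++) :: nat word \<Rightarrow> _)"
  have assoc: "?m (?m p q) r = ?m p (?m q r)" for p q r
    by (rule ultra_prod_assoc) simp
  have cont: "continuous_on UNIV (\<lambda>p. ?m p q)" for q by (rule continuous_on_ultra_prod)
  have CC: "?m p q \<in> ?C" if "p \<in> ?C" "q \<in> ?C" for p q
    by (rule ultra_prod_in_ultras[OF that]) (intro exI[of _ 0] allI impI const_above_add; simp)
  have CW: "?m p q \<in> ?W" if "p \<in> ?C" "q \<in> ?W" for p q
    by (rule ultra_prod_in_ultras[OF that]) (intro exI[of _ 0] allI impI const_var_above_add; simp)
  have WW: "?m p q \<in> ?W" if "p \<in> ?W" "q \<in> ?W" for p q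
    by (rule ultra_prod_in_ultras[OF that]) (intro exI[of _ 0] allI impI const_var_above_add; simp)
  \<comment> \<open>Here the bound on the second factor is \<open>Max (dom x)\<close>.\<close>
  have WC: "?m p q \<in> ?W" if "p \<in> ?W" "q \<in> ?C" for p q
    by (rule ultra_prod_in_ultras[OF that]) (rule exI, intro allI impI, rule var_const_above_add)
  have C0: "?C \<noteq> {}"
  proof (rule ultras_nonempty)
    show "\<exists>x. const_above k n x" for n using const_above_nonempty[of k, OF k] by blast
  qed (rule const_above_antimono)
  have W0: "?W \<noteq> {}"
  proof (rule ultras_nonempty)
    show "\<exists>x. var_above k n x" for n using var_above_nonempty by blast
  qed (rule var_above_antimono)
  have "\<exists>U\<in>?C. ?m U U = U \<and> (\<forall>f\<in>?C. ?m f f = f \<longrightarrow> ?m f U = f \<longrightarrow> ?m U f = f \<longrightarrow> f = U)"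
    by (rule compact_semigroup_minimal_idempotent[of ?m ?C, OF assoc cont compact_ultras C0 CC])
  then obtain U where U: "U \<in> ?C" "?m U U = U"
    and min: "\<And>f. f \<in> ?C \<Longrightarrow> ?m f f = f \<Longrightarrow> ?m f U = f \<Longrightarrow> ?m U f = f \<Longrightarrow> f = U"
    by auto
  \<comment> \<open>Every element of \<open>W U\<close> absorbs \<open>U\<close> on the right, so an
    idempotent found there already satisfies half of being below \<open>U\<close>.\<close>
  let ?X = "(\<lambda>p. ?m p U) ` ?W"
  have "\<exists>e\<in>?X. ?m e e = e"
  proof -
    have "compact ?X"
      by (rule compact_continuous_image[OF continuous_on_subset[OF cont] compact_ultras]) simp
    moreover have "?X \<noteq> {}" using W0 by simp
    moreover have "?m p q \<in> ?X" if pq: "p \<in> ?X" "q \<in> ?X" for p q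
    proof -
      obtain r s where rs: "r \<in> ?W" "s \<in> ?W" "p = ?m r U" "q = ?m s U" using pq by (elim imageE)
      have "?m p q = ?m (?m (?m r U) s) U" using rs by (simp add: assoc)
      moreover have "?m (?m r U) s \<in> ?W" by (intro WW WC rs U)
      ultimately show ?thesis by (rule image_eqI)
    qed
    ultimately show ?thesis
      by (rule compact_semigroup_idempotent[of ?m ?X, OF assoc cont])
  qed
  then obtain s e where s: "s \<in> ?W" and e: "e = ?m s U" "?m e e = e" by blast
  have eU: "?m e U = e" by (simp add: e(1) assoc U(2))
  \<comment> \<open>Multiplying by \<open>U\<close> on the left gives the other half. Idempotence
    survives: \<open>U e U e = U e e = U e\<close>, by \<open>e U = e\<close>.\<close>
  define V where "V = ?m U e"
  have VW: "V \<in> ?W" unfolding V_def e(1) by (intro CW WC s U)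
  have VV: "?m V V = V" by (metis V_def assoc eU e(2))
  have VU: "?m V U = V" by (simp add: V_def assoc eU)
  have UV: "?m U V = V" by (simp add: V_def assoc[symmetric] U(2))
  have uU: "ultra U" and uV: "ultra V" using U VW by (simp_all add: ultras_def)
  show thesis
  proof (rule that[OF uU uV U(2)])
    show "V (var_above k n)" for n using VW by (simp add: ultras_def)
    fix p :: nat assume p: "p \<ge> 1"
    let ?T = "ultra_map (index_subst k p)"
    have TU: "?T U = U"
    proof (rule ext)
      fix A
      have "U (\<lambda>x. A (index_subst k p x)) \<longleftrightarrow> U A"
      proof
        assume "U (\<lambda>x. A (index_subst k p x))"
        then show "U A"
          by (rule ultra_mp[OF uU, where B = "const_above k 0"])
             (use U in \<open>auto simp: ultras_def index_subst_const\<close>)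
      next
        assume "U A"
        then show "U (\<lambda>x. A (index_subst k p x))"
          by (rule ultra_mp[OF uU, where B = "const_above k 0"])
             (use U in \<open>auto simp: ultras_def index_subst_const\<close>)
      qed
      then show "?T U A = U A" by (simp add: ultra_map_def)
    qed
    have hom: "?T (?m a b) = ?m (?T a) (?T b)" for a b
      by (rule ultra_map_prod) (rule index_subst_add)
    have "?T V (const_above k n)" for n
    proof -
      have "V (\<lambda>x. const_above k n (index_subst k p x))"
        by (rule ultra_mono[OF uV, of "var_above k n"])
           (use VW p const_above_index_subst[OF k] in \<open>auto simp: ultras_def\<close>)
      then show ?thesis by (simp add: ultra_map_def)
    qed
    then have "?T V \<in> ?C" using uV by (simp add: ultras_def ultra_ultra_map)
    then show "?T V = U"
      using hom[of V V] hom[of V U] hom[of U V] by (intro min) (simp_all add: VV VU UV TU)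
  qed
qed

section \<open>Acceptance and fusion\<close>

text \<open>Acceptance means that a well-founded tree of \<open>U\<close>-large extensions leads
  into \<open>F\<close>, with no common bound on the lengths of its branches. The explicit set
  \<open>A\<close> keeps the rule monotone for arbitrary \<open>U\<close>.\<close>

inductive accepts :: "(('w \<Rightarrow> bool) \<Rightarrow> bool) \<Rightarrow> 'w list set \<Rightarrow> 'w list \<Rightarrow> bool" for U F where
  member: "s \<in> F \<Longrightarrow> accepts U F s"
| extend: "U A \<Longrightarrow> (\<And>w. A w \<Longrightarrow> accepts U F (s @ [w])) \<Longrightarrow> accepts U F s"

lemma accepts_imp_extension:
  assumes "ultra U" "accepts U F s"
  shows "\<exists>t. s @ t \<in> F"
  using assms(2)
proof induction
  case (member s) then show ?case by (metis append_Nil2)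
next
  case (extend A s)
  then obtain w where "A w" using ultra_ex[OF assms(1)] by blast
  then show ?case using extend.IH by (metis append_assoc)
qed

text \<open>Induction on the acceptance for \<open>F\<close>. If both acceptances proceed by
  extension, their \<open>U\<close>-large sets meet and a common \<open>w\<close> continues the
  branch. If one of them stops in its family, the other still reaches an extension of the same
  tuple, which the assumptions exclude.\<close>

lemma not_accepts_both:
  assumes U: "ultra U"
    and FF': "\<And>s t. s \<in> F \<Longrightarrow> s @ t \<notin> F'" "\<And>s t. s \<in> F' \<Longrightarrow> s @ t \<notin> F"
    and "accepts U F s"
  shows "\<not> accepts U F' s"
  using assms(4)
proof induction
  case (member s) then show ?case using accepts_imp_extension[OF U] FF' by blast
next
  case (extend A s)
  show ?case
  proof
    assume "accepts U F' s"
    then show False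
    proof cases
      case member
      then show False
        using accepts_imp_extension[OF U accepts.extend[OF extend.hyps(1,2)]] FF' by blast
    next
      case (extend B)
      have "U (\<lambda>x. A x \<and> B x)" using U extend \<open>U A\<close> by (simp add: ultra_conj)
      then obtain w where "A w" "B w" using ultra_ex[OF U] by blast
      then show False using \<open>\<And>w. A w \<Longrightarrow> \<not> accepts U F' (s @ [w])\<close> extend by blast
    qed
  qed
qed

text \<open>If the accepted extensions are not \<open>U\<close>-large, then the rejected ones are,
  as \<open>U\<close> decides every predicate. This makes rejection a property that
  \<open>fusion\<close> can preserve.\<close>

lemma rejects_extend:
  assumes "ultra U" "\<not> accepts U F s"
  shows "U (\<lambda>w. \<not> accepts U F (s @ [w]))"
  using assms accepts.extend[of U "\<lambda>w. accepts U F (s @ [w])" F s]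
    ultra_not[OF assms(1), of "\<lambda>w. accepts U F (s @ [w])"]
  by blast

definition index_star :: "(nat \<Rightarrow> nat) \<Rightarrow> (nat \<Rightarrow> nat word) \<Rightarrow> (nat \<times> nat) list \<Rightarrow> nat word" where
  "index_star k u nps = star_list (map (\<lambda>(n, p). index_subst k p (u n)) nps)"

lemma star_list_Cons: "star_list (x # xs) = x ++ star_list xs"
  by (simp add: star_list_def)

lemma star_list_Nil: "star_list [] = Map.empty"
  by (simp add: star_list_def)

text \<open>A state is the finite set of the pairs \<open>(s, x)\<close> where \<open>s\<close> is a tuple already formed and \<open>x\<close> is
  the (possibly empty) beginning of the next word.\<close>

definition next_state :: "(nat \<Rightarrow> nat) \<Rightarrow> nat \<Rightarrow> nat word \<Rightarrow> (nat word list \<times> nat word) set \<Rightarrow>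
    (nat word list \<times> nat word) set" where
  "next_state k n u Z = Z \<union>
    (\<Union>p\<in>{1..k n}. (\<lambda>(s, x). (s, x ++ index_subst k p u)) ` Z) \<union>
    (\<Union>p\<in>{1..k n}. (\<lambda>(s, x). (s @ [x ++ index_subst k p u], Map.empty)) ` Z)"

definition safe_state :: "((nat word \<Rightarrow> bool) \<Rightarrow> bool) \<Rightarrow> (nat word list \<Rightarrow> bool) \<Rightarrow>
    (nat word list \<times> nat word) set \<Rightarrow> bool" where
  "safe_state U good Z \<longleftrightarrow> finite Z \<and> (\<forall>(s, x)\<in>Z. good s \<and> U (\<lambda>w. good (s @ [x ++ w])))"

text \<open>The Galvin-Glazer step. Finitely many requirements, one for each pair in
  \<open>Z\<close> and each letter \<open>p\<close>, hold for \<open>U\<close>-most words. As every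
  substitution maps \<open>V\<close> to \<open>U\<close>, they hold for the substituted forms of
  \<open>V\<close>-most variable words, so one \<open>u\<close> meets them all.\<close>

lemma safe_next_state:
  assumes U: "ultra U" "ultra_prod (++) U U = U" and V: "ultra V" "\<And>n. V (var_above k n)"
    "\<And>p. p \<ge> 1 \<Longrightarrow> ultra_map (index_subst k p) V = U"
    and good: "\<And>s. good s \<Longrightarrow> U (\<lambda>w. good (s @ [w]))"
    and Z: "safe_state U good Z"
  shows "\<exists>u. var_above k N u \<and> safe_state U good (next_state k n u Z)"
proof -
  \<comment> \<open>The two conjuncts allow the partial word to be closed after \<open>w\<close> or
    to be continued beyond it.\<close>
  define ok where "ok s x w \<longleftrightarrow> good (s @ [x ++ w]) \<and> U (\<lambda>w'. good (s @ [x ++ w ++ w']))" for s x w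
  have fin: "finite Z" and inv: "\<And>s x. (s, x) \<in> Z \<Longrightarrow> good s \<and> U (\<lambda>w. good (s @ [x ++ w]))"
    using Z by (auto simp: safe_state_def)
  have okU: "U (ok s x)" if "(s, x) \<in> Z" for s x
  proof -
    \<comment> \<open>Idempotence of \<open>U\<close> splits almost every completion into a next
      piece \<open>w\<close> followed by almost every further completion \<open>w'\<close>.\<close>
    have "ultra_prod (++) U U (\<lambda>w. good (s @ [x ++ w]))" using inv[OF that] U(2) by simp
    then have "U (\<lambda>w. U (\<lambda>w'. good (s @ [x ++ w ++ w'])))" by (simp add: ultra_prod_def)
    then show ?thesis using inv[OF that] unfolding ok_def by (simp add: ultra_conj[OF U(1)])
  qed
  have okV: "V (\<lambda>u. ok s x (index_subst k p u))" if "(s, x) \<in> Z" "p \<ge> 1" for s x p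
    using okU[OF that(1)] V(3)[OF that(2)] by (metis ultra_map_def)
  have "V (\<lambda>u. \<forall>i\<in>Z \<times> {1..k n}. (\<lambda>((s, x), p) u. ok s x (index_subst k p u)) i u)"
    by (subst ultra_ball_finite[OF V(1)]) (use fin okV in auto)
  then have "V (\<lambda>u. var_above k N u \<and>
      (\<forall>i\<in>Z \<times> {1..k n}. (\<lambda>((s, x), p) u. ok s x (index_subst k p u)) i u))"
    using V(2) by (simp add: ultra_conj[OF V(1)])
  then obtain u where u: "var_above k N u"
    "\<forall>i\<in>Z \<times> {1..k n}. (\<lambda>((s, x), p) u. ok s x (index_subst k p u)) i u"
    using ultra_ex[OF V(1)] by blast
  then have ok: "ok s x (index_subst k p u)" if "(s, x) \<in> Z" "p \<in> {1..k n}" for s x p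
    using that by fastforce
  have "safe_state U good (next_state k n u Z)"
    unfolding safe_state_def next_state_def
    using fin inv ok good by (fastforce simp: ok_def)
  then show ?thesis using u(1) by blast
qed

text \<open>Dependent choice iterates \<open>safe_next_state\<close>. Every tuple generated by the
  chosen words appears in some state, and states contain only good tuples.\<close>

lemma fusion:
  assumes U: "ultra U" "ultra_prod (++) U U = U" and V: "ultra V" "\<And>n. V (var_above k n)"
    "\<And>p. p \<ge> 1 \<Longrightarrow> ultra_map (index_subst k p) V = U"
    and good: "\<And>s. good s \<Longrightarrow> U (\<lambda>w. good (s @ [w]))" and "good []"
  obtains u where "\<And>n. var_above k n (u (Suc n))"
    "\<And>n i j. i \<in> dom (u (Suc n)) \<Longrightarrow> j \<in> dom (u (Suc (Suc n))) \<Longrightarrow> i < j"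
    "\<And>npss. [] \<notin> set npss \<Longrightarrow> sorted_wrt (<) (map fst (concat npss)) \<Longrightarrow>
      \<forall>(n, p)\<in>set (concat npss). 1 \<le> n \<and> 1 \<le> p \<and> p \<le> k n \<Longrightarrow>
      good (map (index_star k u) npss)"
proof -
  \<comment> \<open>\<open>Zu\<close> pairs the current state with the variable word chosen last. At
    stage 0 no word has been chosen yet, whence the guards \<open>n > 0\<close>.\<close>
  define P where "P n Zu \<longleftrightarrow> safe_state U good (fst Zu) \<and> ([], Map.empty) \<in> fst Zu \<and>
    (n > 0 \<longrightarrow> var_above k (n - 1) (snd Zu))"
    for n :: nat and Zu :: "(nat word list \<times> nat word) set \<times> nat word"
  define Q where "Q n Zu Zu' \<longleftrightarrow> fst Zu' = next_state k (Suc n) (snd Zu') (fst Zu) \<and>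
    (n > 0 \<longrightarrow> (\<forall>i\<in>dom (snd Zu). \<forall>j\<in>dom (snd Zu'). i < j))"
    for n :: nat and Zu Zu' :: "(nat word list \<times> nat word) set \<times> nat word"
  have "\<exists>f. \<forall>n. P n (f n) \<and> Q n (f n) (f (Suc n))"
  proof (rule dependent_nat_choice)
    have "P 0 ({([], Map.empty)}, Map.empty)"
      using good[of "[]"] \<open>good []\<close> by (simp add: P_def safe_state_def)
    then show "\<exists>Zu. P 0 Zu" by blast
    fix Zu n assume Zu: "P n Zu"
    \<comment> \<open>The new word must lie beyond its predecessor. It must also lie beyond
      \<open>n\<close>, so that every position of \<open>u (Suc n)\<close> is at least
      \<open>Suc n\<close>; this later gives \<open>k n \<le> k i\<close> at the positions
      \<open>i\<close> of \<open>u n\<close>.\<close>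
    let ?N = "n + (if n = 0 then 0 else Max (dom (snd Zu)))"
    obtain u where u: "var_above k ?N u" "safe_state U good (next_state k (Suc n) u (fst Zu))"
      using safe_next_state[OF U V good, of "fst Zu" ?N "Suc n"] Zu by (auto simp: P_def)
    have "i < j" if "n > 0" "i \<in> dom (snd Zu)" "j \<in> dom u" for i j
    proof -
      have "i \<le> Max (dom (snd Zu))"
        using Zu that by (intro Max_ge) (auto simp: P_def var_above_def)
      also have "\<dots> \<le> ?N" using that by simp
      also have "\<dots> < j" using u(1) that by (auto simp: var_above_def)
      finally show ?thesis .
    qed
    moreover have "var_above k n u" using u(1) by (rule var_above_antimono) simp
    ultimately have "P (Suc n) (next_state k (Suc n) u (fst Zu), u) \<and>
        Q n Zu (next_state k (Suc n) u (fst Zu), u)"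
      using u(2) Zu by (auto simp: P_def Q_def next_state_def)
    then show "\<exists>Zu'. P (Suc n) Zu' \<and> Q n Zu Zu'" by blast
  qed
  then obtain f where P: "\<And>n. P n (f n)" and Q: "\<And>n. Q n (f n) (f (Suc n))" by blast
  define Z where "Z n = fst (f n)" for n
  define u where "u n = snd (f n)" for n
  have Z0: "([], Map.empty) \<in> Z n" for n using P[of n] by (simp add: P_def Z_def)
  have Zgood: "good s" if "(s, x) \<in> Z n" for n s x
    using P[of n] that by (auto simp: P_def Z_def safe_state_def)
  have ZSuc: "Z (Suc n) = next_state k (Suc n) (u (Suc n)) (Z n)" for n
    using Q[of n] by (simp add: Q_def Z_def u_def)
  have Zmono: "Z m \<subseteq> Z n" if "m \<le> n" for m n
    by (rule lift_Suc_mono_le[OF _ that]) (simp add: ZSuc next_state_def le_supI1)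
  \<comment> \<open>The first pair, with the word still open, carries the induction when more
    factors follow; the second records the word closed after its last factor. Skipped indices are
    bridged by \<open>Zmono\<close>.\<close>
  have word: "(s, x ++ index_star k u nps) \<in> Z (fst (last nps)) \<and>
      (s @ [x ++ index_star k u nps], Map.empty) \<in> Z (fst (last nps))"
    if "nps \<noteq> []" "(s, x) \<in> Z n" "sorted_wrt (<) (map fst nps)"
      "\<forall>(m, p)\<in>set nps. n < m \<and> 1 \<le> p \<and> p \<le> k m" for n s x nps
    using that
  proof (induction nps arbitrary: n x)
    case Nil then show ?case by simp
  next
    case (Cons a nps)
    obtain m p where a: "a = (m, p)" by (cases a)
    have mp: "n < m" "1 \<le> p" "p \<le> k m" using Cons.prems a by auto
    obtain m' where m': "m = Suc m'" using mp by (cases m) auto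
    have "(s, x) \<in> Z m'" using Cons.prems Zmono[of n m'] mp m' by auto
    then have *: "(s, x ++ index_subst k p (u m)) \<in> Z m"
      "(s @ [x ++ index_subst k p (u m)], Map.empty) \<in> Z m"
      unfolding m' ZSuc next_state_def using mp m' by force+
    show ?case
    proof (cases "nps = []")
      case True
      then show ?thesis using * by (simp add: a index_star_def star_list_Cons star_list_Nil)
    next
      case False
      have "\<forall>(m', p)\<in>set nps. m < m' \<and> 1 \<le> p \<and> p \<le> k m'" using Cons.prems a by fastforce
      from Cons.IH[OF False *(1) _ this] Cons.prems False show ?thesis
        by (simp add: a index_star_def star_list_Cons)
    qed
  qed
  have tuple: "good (s @ map (index_star k u) npss)"
    if "(s, Map.empty) \<in> Z n" "[] \<notin> set npss" "sorted_wrt (<) (map fst (concat npss))"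
      "\<forall>(m, p)\<in>set (concat npss). n < m \<and> 1 \<le> p \<and> p \<le> k m" for n s npss
    using that
  proof (induction npss arbitrary: n s)
    case Nil then show ?case using Zgood by auto
  next
    case (Cons nps npss)
    have ne: "nps \<noteq> []" using Cons.prems by auto
    have "(s @ [Map.empty ++ index_star k u nps], Map.empty) \<in> Z (fst (last nps))"
      using word[of nps s Map.empty n] Cons.prems ne by (auto simp: sorted_wrt_append)
    moreover have "\<forall>(m, p)\<in>set (concat npss). fst (last nps) < m \<and> 1 \<le> p \<and> p \<le> k m"
    proof (intro ballI)
      fix mp assume mp: "mp \<in> set (concat npss)"
      have "fst (last nps) < fst mp"
        using Cons.prems(3) mp last_in_set[OF ne] by (auto simp: sorted_wrt_append)
      then show "case mp of (m, p) \<Rightarrow> fst (last nps) < m \<and> 1 \<le> p \<and> p \<le> k m"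
        using Cons.prems(4) mp by fastforce
    qed
    ultimately have "good ((s @ [Map.empty ++ index_star k u nps]) @ map (index_star k u) npss)"
      using Cons.prems by (intro Cons.IH) (auto simp: sorted_wrt_append)
    then show ?case by simp
  qed
  show thesis
  proof (rule that[of u])
    show "var_above k n (u (Suc n))" for n using P[of "Suc n"] by (simp add: P_def u_def)
    show "i < j" if "i \<in> dom (u (Suc n))" "j \<in> dom (u (Suc (Suc n)))" for n i j
      using Q[of "Suc n"] that unfolding Q_def u_def by blast
    show "good (map (index_star k u) npss)" if "[] \<notin> set npss"
      "sorted_wrt (<) (map fst (concat npss))"
      "\<forall>(n, p)\<in>set (concat npss). 1 \<le> n \<and> 1 \<le> p \<and> p \<le> k n" for npss
      using tuple[of "[]" 0 npss] that Z0 by (simp add: Suc_le_eq)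
  qed
qed

section \<open>Schreier families are thin\<close>

lemma cord_add_1_eq_iff: "x + 1 = y + (1 :: cord) \<longleftrightarrow> x = y"
  by (metis antisym less_add_1_cord cord_less_add_1)

lemma cord_add_left_cancel: "x + y = x + z \<longleftrightarrow> y = (z :: cord)"
  by (metis cord_add_strict less_irrefl not_less_iff_gr_or_eq)

lemma not_less_zero_cord [simp]: "\<not> x < (0 :: cord)"
  by (simp add: not_less)

lemma cord_zero_less_one: "0 < (1 :: cord)"
  by (simp add: less_one_cord)

lemma cord_of_nat_less_omega: "cord_of_nat n < omega"
proof -
  have "cord_of_nat n < cord_of_nat (Suc n)" by (simp add: cord_less_add_1)
  also have "\<dots> \<le> omega" unfolding omega_def by (rule cord_Sup_upper) (simp_all del: cord_of_nat.simps)
  finally show ?thesis .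
qed

lemma less_omega_add_1: assumes "v < omega" shows "v + 1 < omega"
proof -
  have "\<exists>n. v < cord_of_nat n"
  proof (rule ccontr)
    assume "\<nexists>n. v < cord_of_nat n"
    then have "omega \<le> v" unfolding omega_def by (intro Sup_cord_least) (auto simp: not_less)
    then show False using assms by simp
  qed
  then obtain n where "v < cord_of_nat n" by blast
  then have "v + 1 \<le> cord_of_nat n" by (rule cord_add_1_le)
  then show ?thesis using cord_of_nat_less_omega by (rule le_less_trans)
qed

lemma cord_of_nat_mono: "m \<le> n \<Longrightarrow> cord_of_nat m \<le> cord_of_nat n"
  by (rule lift_Suc_mono_le[of cord_of_nat]) (simp_all add: le_cord_add)

lemma omega_pow_mult_less:
  assumes "z < x" "v < omega" shows "omega_pow z * v + omega_pow z \<le> omega_pow x"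
  using cord_mult_upper[OF assms(2)] omega_pow_upper(1)[OF assms(1)] by (rule order_trans)

lemma omega_pow_pos: "0 < omega_pow x"
  using cord_zero_less_one omega_pow_upper(2) by (rule less_le_trans)

lemma cord_mult_1: "x * 1 = (x :: cord)"
  using cord_mult_Suc[of x 0] by (simp add: cord_mult_0 cord_0_add)

lemma omega_pow_strict_mono: assumes "z < x" shows "omega_pow z < omega_pow x"
proof -
  have "omega_pow z < omega_pow z + omega_pow z"
    using cord_add_strict[OF omega_pow_pos[of z], of "omega_pow z"] by (simp add: cord_add_0)
  also have "\<dots> = omega_pow z * 1 + omega_pow z" by (simp add: cord_mult_1)
  also have "1 < omega" using cord_of_nat_less_omega[of 1] by (simp add: cord_0_add)
  then have "omega_pow z * 1 + omega_pow z \<le> omega_pow x" by (rule omega_pow_mult_less[OF assms])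
  finally show ?thesis .
qed

lemma omega_pow_less_iff: "omega_pow x < omega_pow y \<longleftrightarrow> x < y"
  by (metis omega_pow_mono omega_pow_strict_mono not_less)

lemma omega_pow_eq_iff: "omega_pow x = omega_pow y \<longleftrightarrow> x = y"
  by (metis omega_pow_less_iff less_irrefl not_less_iff_gr_or_eq)

text \<open>An ordinal \<open>y\<close> below the power lies below some
  \<open>omega_pow z * (v + 1)\<close> with \<open>z < x\<close> and \<open>v < omega\<close>. Then
  \<open>y + 1\<close> is still below \<open>omega_pow z * (v + 2)\<close>, which does not exceed
  \<open>omega_pow x\<close>.\<close>

lemma omega_pow_neq_Suc: assumes "0 < x" shows "omega_pow x \<noteq> y + 1"
proof
  assume eq: "omega_pow x = y + 1"
  then have y: "y < omega_pow x" by (simp add: cord_less_add_1)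
  have "y + 1 < omega_pow x"
  proof (cases "y = 0")
    case True
    then show ?thesis using omega_pow_strict_mono[OF assms] by (simp add: omega_pow_0 cord_0_add)
  next
    case False
    \<comment> \<open>\<open>omega_pow_least\<close> applies only to bounds that are at least 1,
      hence the separate treatment of \<open>y = 0\<close>.\<close>
    then have "\<not> y < 1" by (simp add: less_one_cord)
    then have "\<exists>z<x. y < omega_pow z * omega"
      using omega_pow_least[of y x] y by (metis not_less)
    then obtain z where z: "z < x" "y < omega_pow z * omega" by blast
    then have "\<exists>v<omega. y < omega_pow z * v + omega_pow z"
      using cord_mult_least[of omega "omega_pow z" y] by (metis not_less)
    then obtain v where v: "v < omega" "y < omega_pow z * v + omega_pow z" by blast
    have "y + 1 \<le> omega_pow z * (v + 1)" using v(2) by (simp add: cord_mult_Suc cord_add_1_le)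
    also have "\<dots> < omega_pow z * (v + 1) + omega_pow z"
      using cord_add_strict[OF omega_pow_pos[of z], of "omega_pow z * (v + 1)"] by (simp add: cord_add_0)
    also have "\<dots> \<le> omega_pow x" by (rule omega_pow_mult_less[OF z(1) less_omega_add_1[OF v(1)]])
    finally show ?thesis .
  qed
  then show False using eq by simp
qed

lemma cantor_sum_Cons: "cantor_sum ((a, p) # cs) = omega_pow a * cord_of_nat p + cantor_sum cs"
  by (simp add: cantor_sum_def)

lemma cantor_sum_Nil: "cantor_sum [] = 0"
  by (simp add: cantor_sum_def)

text \<open>By induction the tail is below \<open>omega_pow a\<close>, so the whole sum stays below
  \<open>p + 1\<close> copies of \<open>omega_pow a\<close>, and finitely many copies fit below the
  next power.\<close>

lemma cantor_sum_less:
  assumes "sorted_wrt (>) (map fst cs)" "\<forall>(a, p)\<in>set cs. a < c"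
  shows "cantor_sum cs < omega_pow c"
  using assms
proof (induction cs arbitrary: c)
  case Nil then show ?case by (simp add: cantor_sum_Nil omega_pow_pos)
next
  case (Cons ap cs)
  obtain a p where ap: "ap = (a, p)" by (cases ap)
  have "cantor_sum cs < omega_pow a" using Cons.prems ap by (intro Cons.IH) auto
  then have "cantor_sum (ap # cs) < omega_pow a * cord_of_nat p + omega_pow a"
    unfolding ap cantor_sum_Cons by (rule cord_add_strict)
  also have "\<dots> \<le> omega_pow c"
    using Cons.prems ap by (intro omega_pow_mult_less cord_of_nat_less_omega) auto
  finally show ?case .
qed

lemma cantor_sum_head_ge:
  assumes "p \<ge> 1" shows "omega_pow a \<le> cantor_sum ((a, p) # cs)"
proof -
  have "cord_of_nat 1 \<le> cord_of_nat p" using assms by (rule cord_of_nat_mono)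
  then have "omega_pow a * 1 \<le> omega_pow a * cord_of_nat p"
    by (intro cord_mult_mono) (simp add: cord_0_add)
  then show ?thesis
    unfolding cantor_sum_Cons by (metis cord_mult_1 le_cord_add order_trans)
qed

lemma cantor_sum_head_coeff_less:
  assumes "sorted_wrt (>) (a # map fst cs)" "p < q"
  shows "cantor_sum ((a, p) # cs) < cantor_sum ((a, q) # ds)"
proof -
  have "cantor_sum cs < omega_pow a" using assms by (intro cantor_sum_less) auto
  then have "cantor_sum ((a, p) # cs) < omega_pow a * cord_of_nat p + omega_pow a"
    unfolding cantor_sum_Cons by (rule cord_add_strict)
  also have "\<dots> = omega_pow a * cord_of_nat (Suc p)" by (simp add: cord_mult_Suc)
  also have "\<dots> \<le> omega_pow a * cord_of_nat q"
    using assms by (intro cord_mult_mono cord_of_nat_mono) simp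
  also have "\<dots> \<le> cantor_sum ((a, q) # ds)" unfolding cantor_sum_Cons by (rule le_cord_add)
  finally show ?thesis .
qed

text \<open>Uniqueness of the Cantor normal form. Unequal leading exponents, and then unequal
  leading coefficients, would give different sums; left cancellation passes to the tails. This makes
  the rule \<open>sum\<close> of \<open>in_schreier\<close> invertible.\<close>

lemma cantor_sum_inj:
  assumes "sorted_wrt (>) (map fst cs)" "\<forall>(a, p)\<in>set cs. p \<ge> 1"
    "sorted_wrt (>) (map fst ds)" "\<forall>(a, p)\<in>set ds. p \<ge> 1"
    "cantor_sum cs = cantor_sum ds"
  shows "cs = ds"
  using assms
proof (induction cs arbitrary: ds)
  case Nil
  show ?case
  proof (cases ds)
    case (Cons bq ds')
    then have "0 < cantor_sum ds"
      using Nil.prems omega_pow_pos cantor_sum_head_ge less_le_trans by (cases bq) fastforce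
    then show ?thesis using Nil by (simp add: cantor_sum_Nil)
  qed simp
next
  case (Cons ap cs)
  obtain a p where ap: "ap = (a, p)" by (cases ap)
  have le: "omega_pow a \<le> cantor_sum ds"
    using Cons.prems ap cantor_sum_head_ge[of p a cs] by auto
  then have "0 < cantor_sum ds" using omega_pow_pos less_le_trans by blast
  then obtain b q ds' where ds: "ds = (b, q) # ds'"
    by (cases ds) (auto simp: cantor_sum_Nil)
  have ge: "omega_pow b \<le> cantor_sum (ap # cs)"
    using Cons.prems ds cantor_sum_head_ge[of q b ds'] by auto
  have "\<not> a < b"
  proof
    assume "a < b"
    then have "cantor_sum (ap # cs) < omega_pow b"
      using Cons.prems(1) ap by (intro cantor_sum_less) (auto intro: less_trans)
    then show False using ge by simp
  qed
  moreover have "\<not> b < a"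
  proof
    assume "b < a"
    then have "cantor_sum ds < omega_pow a"
      using Cons.prems(3) ds by (intro cantor_sum_less) (auto intro: less_trans)
    then show False using le by simp
  qed
  ultimately have ab: "a = b" by simp
  have "\<not> p < q" using cantor_sum_head_coeff_less[of a cs p q ds'] Cons.prems ap ds ab by auto
  moreover have "\<not> q < p" using cantor_sum_head_coeff_less[of a ds' q p cs] Cons.prems ap ds ab by auto
  ultimately have pq: "p = q" by simp
  have "cantor_sum cs = cantor_sum ds'"
    using Cons.prems(5) unfolding ap ds ab pq cantor_sum_Cons by (simp add: cord_add_left_cancel)
  then have "cs = ds'" using Cons.prems ds by (intro Cons.IH) auto
  then show ?case using ap ds ab pq by simp
qed

section \<open>Thin families and the constructions that preserve thinness\<close>

definition initial_segment :: "nat set \<Rightarrow> nat set \<Rightarrow> bool" where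
  "initial_segment s t \<longleftrightarrow> s \<subseteq> t \<and> (\<forall>x\<in>s. \<forall>y\<in>t - s. x < y)"

definition thin :: "nat set set \<Rightarrow> bool" where
  "thin F \<longleftrightarrow> (\<forall>s\<in>F. \<forall>t\<in>F. initial_segment s t \<longrightarrow> s = t)"

definition concats :: "nat set set \<Rightarrow> nat set set \<Rightarrow> nat set set" where
  "concats F G = {a \<union> b | a b. a \<in> F \<and> b \<in> G \<and> (\<forall>x\<in>a. \<forall>y\<in>b. x < y)}"

lemma thin_subset: "thin G \<Longrightarrow> F \<subseteq> G \<Longrightarrow> thin F"
  by (auto simp: thin_def)

lemma initial_segments_comparable:
  assumes "initial_segment s u" "initial_segment t u"
  shows "initial_segment s t \<or> initial_segment t s"
proof (cases "s \<subseteq> t")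
  case True
  then show ?thesis using assms by (auto simp: initial_segment_def)
next
  case False
  then obtain x where x: "x \<in> s" "x \<notin> t" by blast
  have "y \<in> s" if "y \<in> t" for y
  proof (rule ccontr)
    assume "y \<notin> s"
    then have "x < y" "y < x" using assms x that by (auto simp: initial_segment_def)
    then show False by simp
  qed
  then show ?thesis using assms by (auto simp: initial_segment_def)
qed

text \<open>The two first parts are both initial segments of the larger set, hence comparable, hence
  equal by thinness of \<open>F\<close>. Removing them leaves an initial segment relation between
  the second parts.\<close>

lemma thin_concats:
  assumes "thin F" "thin G" shows "thin (concats F G)"
  unfolding thin_def
proof (intro ballI impI)
  fix s t assume s: "s \<in> concats F G" and t: "t \<in> concats F G" and st: "initial_segment s t"
  obtain a b where ab: "s = a \<union> b" "a \<in> F" "b \<in> G" "\<forall>x\<in>a. \<forall>y\<in>b. x < y"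
    using s by (auto simp: concats_def)
  obtain c d where cd: "t = c \<union> d" "c \<in> F" "d \<in> G" "\<forall>x\<in>c. \<forall>y\<in>d. x < y"
    using t by (auto simp: concats_def)
  have "initial_segment a t" "initial_segment c t"
    using st ab cd by (auto simp: initial_segment_def)
  then have "initial_segment a c \<or> initial_segment c a" by (rule initial_segments_comparable)
  then have ac: "a = c" using assms(1) ab cd by (auto simp: thin_def)
  have "a \<inter> b = {}" "a \<inter> d = {}" using ab cd ac by fastforce+
  then have "initial_segment b d" using st ab(1) cd(1) ac by (auto simp: initial_segment_def)
  then show "s = t" using assms(2) ab cd ac by (auto simp: thin_def)
qed

lemma set_less_pointwise: "finite s \<Longrightarrow> finite t \<Longrightarrow> set_less s t \<Longrightarrow> x \<in> s \<Longrightarrow> y \<in> t \<Longrightarrow> x < y"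
  unfolding set_less_def by (meson Max_ge Min_le le_less_trans less_le_trans)

lemma successive_unions_finite:
  "\<forall>s\<in>F. finite s \<Longrightarrow> t \<in> successive_unions F p \<Longrightarrow> finite t"
  by (auto simp: successive_unions_def)

text \<open>With the number of blocks fixed, splitting off the first block reduces the claim to
  \<open>thin_concats\<close>.\<close>

lemma thin_successive_unions:
  assumes F: "thin F" "\<forall>s\<in>F. finite s"
  shows "thin (successive_unions F p)"
proof (induction p)
  case 0
  then show ?case by (auto simp: successive_unions_def thin_def)
next
  case (Suc p)
  have "successive_unions F (Suc p) \<subseteq> concats F (successive_unions F p)"
  proof
    fix t assume "t \<in> successive_unions F (Suc p)"
    then obtain ts where ts: "t = \<Union>(set ts)" "length ts = Suc p" "set ts \<subseteq> F" "sorted_wrt set_less ts"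
      by (auto simp: successive_unions_def)
    then obtain a r where ar: "ts = a # r" by (cases ts) auto
    have "t = a \<union> \<Union>(set r)" "a \<in> F" using ts ar by auto
    moreover have "\<Union>(set r) \<in> successive_unions F p"
      using ts ar by (auto simp: successive_unions_def)
    moreover have "\<forall>x\<in>a. \<forall>y\<in>\<Union>(set r). x < y"
      using ts ar F(2) set_less_pointwise by (metis UnionE insert_subset list.simps(15) sorted_wrt.simps(2) subset_code(1))
    ultimately show "t \<in> concats F (successive_unions F p)" unfolding concats_def by blast
  qed
  then show ?case using thin_concats[OF F(1) Suc] thin_subset by blast
qed

text \<open>The list is decreasing, so its head is the rightmost block and becomes the second part
  in \<open>concats\<close>.\<close>

lemma thin_decreasing_unions:
  assumes "\<forall>i<length Fs. thin (Fs ! i) \<and> (\<forall>s\<in>Fs ! i. finite s)"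
  shows "thin {\<Union>(set ss) | ss. length ss = length Fs \<and> (\<forall>i<length Fs. ss ! i \<in> Fs ! i) \<and>
    sorted_wrt (\<lambda>s t. set_less t s) ss}" (is "thin (?D Fs)")
  using assms
proof (induction Fs)
  case Nil
  then show ?case by (auto simp: thin_def)
next
  case (Cons F Fs)
  have F: "thin F" "\<forall>s\<in>F. finite s" and Fs: "\<forall>i<length Fs. thin (Fs ! i) \<and> (\<forall>s\<in>Fs ! i. finite s)"
    using Cons.prems by (auto simp: nth_Cons split: nat.splits)
  have "?D (F # Fs) \<subseteq> concats (?D Fs) F"
  proof
    fix t assume "t \<in> ?D (F # Fs)"
    then obtain ss where ss: "t = \<Union>(set ss)" "length ss = Suc (length Fs)"
      "\<forall>i<Suc (length Fs). ss ! i \<in> (F # Fs) ! i" "sorted_wrt (\<lambda>s t. set_less t s) ss"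
      by auto
    then obtain a r where ar: "ss = a # r" by (cases ss) auto
    have a: "a \<in> F" using ss(3) ar by auto
    have r: "\<forall>i<length Fs. r ! i \<in> Fs ! i" using ss(3) ar by auto
    have len: "length r = length Fs" using ss ar by simp
    have "\<forall>x\<in>\<Union>(set r). \<forall>y\<in>a. x < y"
    proof (intro ballI)
      fix x y assume x: "x \<in> \<Union>(set r)" and y: "y \<in> a"
      then obtain b where b: "b \<in> set r" "x \<in> b" by blast
      then obtain i where i: "i < length r" "b = r ! i" by (auto simp: in_set_conv_nth)
      have "finite b" using i r len Fs by auto
      moreover have "finite a" using F a by blast
      moreover have "set_less b a" using ss(4) ar b by auto
      ultimately show "x < y" using set_less_pointwise b y by blast
    qed
    moreover have "t = \<Union>(set r) \<union> a" using ss(1) ar by auto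
    moreover have "\<Union>(set r) \<in> ?D Fs" using r len ss(4) ar by auto
    ultimately show "t \<in> concats (?D Fs) F" unfolding concats_def using a by blast
  qed
  then show ?case using thin_concats[OF Cons.IH[OF Fs] F(1)] thin_subset by blast
qed

section \<open>Inversion of the rules for Schreier families, and their thinness\<close>

lemma in_schreier_finite_pos: "in_schreier fs \<xi> s \<Longrightarrow> finite s \<and> (\<forall>n\<in>s. 1 \<le> n)"
proof (induction rule: in_schreier.induct)
  case (omega_pow_Suc s \<beta>)
  then show ?case by (auto simp: successive_unions_def)
next
  case (sum \<xi> cs \<alpha> p cs' ss)
  have "finite s \<and> (\<forall>n\<in>s. 1 \<le> n)" if s: "s \<in> set ss" for s
  proof -
    obtain i where i: "i < length ss" "s = ss ! i" using s by (auto simp: in_set_conv_nth)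
    then show ?thesis using sum by (fastforce simp: successive_unions_def)
  qed
  then show ?case by blast
qed simp_all


lemma in_schreier_finite: "in_schreier fs \<xi> s \<Longrightarrow> finite s"
  by (simp add: in_schreier_finite_pos)

lemma omega_pow_eq_one_iff: "omega_pow x = 1 \<longleftrightarrow> x = 0"
  using omega_pow_eq_iff[of x 0] by (simp add: omega_pow_0)

lemma omega_pow_eq_SucD: "omega_pow x = y + 1 \<Longrightarrow> x = 0 \<and> y = 0"
  using omega_pow_neq_Suc[of x y] zero_cord_le[of x] cord_add_1_eq_iff[of 0 y]
  by (auto simp: omega_pow_0 cord_0_add le_less)

lemma not_limit_Suc: "\<not> limit_cord (x + 1)"
  by (auto simp: limit_cord_def)

lemma not_limit_one: "\<not> limit_cord 1"
  using not_limit_Suc[of 0] by (simp add: cord_0_add)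

lemma fundamental_sequence_less:
  assumes "fundamental_sequences fs" "limit_cord l" "n \<ge> 1"
  shows "fs l n < l"
proof -
  have "strict_mono_on {1..} (fs l)" and sup: "(SUP n\<in>{1..}. fs l n) = l"
    using assms(1,2) by (auto simp: fundamental_sequences_def)
  then have "fs l n < fs l (Suc n)" using assms(3) by (auto simp: strict_mono_on_def)
  also have "\<dots> \<le> (SUP n\<in>{1..}. fs l n)" by (rule cord_Sup_upper) auto
  finally show ?thesis by (simp only: sup)
qed

text \<open>The rules are indexed by ordinals, not by constructors, so inversion rests on
  arithmetic: a successor above 1 is neither 0 nor 1, nor a power of omega, nor a limit.\<close>

lemma in_schreier_Suc_cases:
  assumes "in_schreier fs (\<zeta> + 1) s" "\<zeta> \<ge> 1"
  obtains n t where "s = {n} \<union> t" "in_schreier fs \<zeta> t" "set_less {n} t"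
  using assms(1)
proof cases
  case zero
  then show ?thesis using cord_less_add_1[of \<zeta>] by simp
next
  case (one n)
  then have "\<zeta> + 1 = 0 + 1" by (simp add: cord_0_add)
  then show ?thesis using assms(2) cord_zero_less_one by (simp add: cord_add_1_eq_iff)
next
  case (Suc \<zeta>' n t)
  then show ?thesis using that by (simp add: cord_add_1_eq_iff)
next
  case (omega_pow_Suc \<beta>)
  then show ?thesis using omega_pow_eq_SucD[of "\<beta> + 1" \<zeta>] assms(2) cord_zero_less_one by simp
next
  case (omega_pow_limit l)
  then show ?thesis using omega_pow_eq_SucD[of l \<zeta>] assms(2) cord_zero_less_one by simp
next
  case sum
  then show ?thesis using not_limit_Suc by blast
qed

text \<open>No exponent lies strictly between \<open>a\<close> and \<open>a + 1\<close>. This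
  separates the rule \<open>sum\<close> from the two rules for powers of omega.\<close>

lemma omega_pow_not_between:
  assumes "omega_pow a < omega_pow b" "omega_pow b < omega_pow (a + 1)"
  shows False
  using assms by (auto simp: omega_pow_less_iff less_add_1_cord)

lemma omega_pow_neq_zero: "omega_pow x \<noteq> 0"
  using omega_pow_pos[of x] by simp

lemma in_schreier_omega_pow_Suc_cases:
  assumes "in_schreier fs (omega_pow (\<beta> + 1)) s"
  shows "s \<noteq> {} \<and> s \<in> successive_unions {t. in_schreier fs (omega_pow \<beta>) t} (Min s)"
  using assms
proof cases
  case (Suc \<zeta>)
  then show ?thesis
    using omega_pow_eq_SucD[of "\<beta> + 1" \<zeta>] cord_less_add_1[of \<beta>] zero_cord_le[of \<beta>] by simp
next
  case one
  then show ?thesis using cord_less_add_1[of \<beta>] by (simp add: omega_pow_eq_one_iff)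
next
  case (omega_pow_Suc \<beta>')
  then show ?thesis by (simp add: omega_pow_eq_iff cord_add_1_eq_iff)
next
  case (omega_pow_limit l)
  then show ?thesis using not_limit_Suc[of \<beta>] by (simp add: omega_pow_eq_iff)
next
  case (sum cs \<alpha> p cs' ss)
  then show ?thesis using omega_pow_not_between by blast
qed (use omega_pow_neq_zero in auto)

lemma in_schreier_omega_pow_limit_cases:
  assumes "in_schreier fs (omega_pow l) s" "limit_cord l"
  shows "s \<noteq> {} \<and> in_schreier fs (omega_pow (fs l (Min s))) s"
proof -
  have l: "l \<noteq> 0" "l \<noteq> 1" using assms(2) not_limit_one by (auto simp: limit_cord_def)
  from assms(1) show ?thesis
  proof cases
    case (Suc \<zeta>)
    then show ?thesis using omega_pow_eq_SucD[of l \<zeta>] l by simp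
  next
    case one
    then show ?thesis using l by (simp add: omega_pow_eq_one_iff)
  next
    case (omega_pow_Suc \<beta>')
    then show ?thesis using not_limit_Suc assms(2) by (auto simp: omega_pow_eq_iff)
  next
    case (omega_pow_limit l')
    then show ?thesis by (simp add: omega_pow_eq_iff)
  next
    case (sum cs \<alpha> p cs' ss)
    then show ?thesis using omega_pow_not_between by blast
  qed (use omega_pow_neq_zero in auto)
qed

lemma in_schreier_sum_cases:
  assumes "in_schreier fs \<xi> s" "limit_cord \<xi>" "\<xi> = cantor_sum cs" "sorted_wrt (>) (map fst cs)"
    "\<forall>(a, q)\<in>set cs. q \<ge> 1" "omega_pow \<alpha> < \<xi>" "\<xi> < omega_pow (\<alpha> + 1)"
  obtains ss where "s = \<Union>(set ss)" "length ss = length cs"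
    "\<forall>i<length cs. ss ! i \<in>
      successive_unions {t. in_schreier fs (omega_pow (fst (cs ! i))) t} (snd (cs ! i))"
    "sorted_wrt (\<lambda>s t. set_less t s) ss"
  using assms(1)
proof cases
  case zero
  then show ?thesis using assms(2) by (simp add: limit_cord_def)
next
  case one
  then show ?thesis using assms(2) not_limit_one by simp
next
  case Suc
  then show ?thesis using assms(2) not_limit_Suc by simp
next
  case (omega_pow_Suc \<beta>)
  then show ?thesis using omega_pow_not_between assms(6,7) by blast
next
  case (omega_pow_limit l)
  then show ?thesis using omega_pow_not_between assms(6,7) by blast
next
  case (sum ds \<alpha>' p ds' ss)
  \<comment> \<open>The derivation comes with its own list \<open>ds\<close>; uniqueness of the
    normal form identifies it with the given one.\<close>
  have "cs = ds"
    by (rule cantor_sum_inj) (use sum assms in \<open>auto split: prod.splits\<close>)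
  then show ?thesis using sum that by blast
qed

text \<open>In the rules for powers of omega the minimum selects the number of blocks or the term of
  the fundamental sequence. A shared minimum makes both sets unfold with the same parameter.\<close>

lemma initial_segment_Min:
  assumes "initial_segment s t" "s \<noteq> {}" "finite t"
  shows "Min t = Min s"
proof -
  have fin: "finite s" and "s \<subseteq> t" using assms finite_subset by (auto simp: initial_segment_def)
  have "Min s \<in> s" using fin assms(2) by simp
  moreover have "Min s \<le> y" if "y \<in> t" for y
    using assms(1) that fin \<open>Min s \<in> s\<close> by (cases "y \<in> s") (auto simp: initial_segment_def intro: less_imp_le)
  ultimately show ?thesis using \<open>s \<subseteq> t\<close> assms(3) by (intro Min_eqI) auto
qed

text \<open>Induction on \<open>\<xi>\<close>. By inversion \<open>s\<close> and \<open>t\<close>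
  arise from the same rule with the same parameters, out of families of smaller index, and each
  construction preserves thinness.\<close>

lemma thin_schreier:
  assumes fs: "fundamental_sequences fs"
  shows "thin (schreier fs \<xi>)"
proof (induction \<xi> rule: less_induct)
  case (less \<xi>)
  show ?case
    unfolding thin_def
  proof (intro ballI impI)
    fix s t assume "s \<in> schreier fs \<xi>" "t \<in> schreier fs \<xi>" and st: "initial_segment s t"
    then have s: "in_schreier fs \<xi> s" and t: "in_schreier fs \<xi> t" by (simp_all add: schreier_def)
    have fin: "\<forall>s\<in>schreier fs \<zeta>. finite s" for \<zeta> by (simp add: schreier_def in_schreier_finite)
    have thinD: "s' = t'" if "thin F" "s' \<in> F" "t' \<in> F" "initial_segment s' t'" for F s' t'
      using that by (simp add: thin_def)
    from s show "s = t"
    proof cases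
      case zero
      with t have "in_schreier fs 0 t" by simp
      then have "t = {}"
      proof cases
        case (Suc \<zeta>)
        then show ?thesis using cord_less_add_1[of \<zeta>] zero_cord_le[of \<zeta>] by simp
      qed (use cord_zero_less_one omega_pow_neq_zero in \<open>auto simp: limit_cord_def\<close>)
      then show ?thesis using zero by simp
    next
      case (one n)
      with t have "in_schreier fs 1 t" by simp
      then have "\<exists>m. t = {m}"
      proof cases
        case (Suc \<zeta>)
        then have "0 + 1 = \<zeta> + 1" by (simp add: cord_0_add)
        then show ?thesis using Suc cord_zero_less_one unfolding cord_add_1_eq_iff by simp
      next
        case (omega_pow_Suc \<beta>)
        then show ?thesis using omega_pow_eq_one_iff[of "\<beta> + 1"] cord_less_add_1[of \<beta>] by simp
      next
        case (omega_pow_limit l)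
        then show ?thesis using omega_pow_eq_one_iff[of l] by (simp add: limit_cord_def)
      qed (use cord_zero_less_one not_limit_one in auto)
      then show ?thesis using one st by (auto simp: initial_segment_def)
    next
      case (Suc \<zeta> n r)
      then obtain m q where m: "t = {m} \<union> q" "in_schreier fs \<zeta> q" "set_less {m} q"
        using t in_schreier_Suc_cases by metis
      let ?F = "concats (range (\<lambda>n. {n})) (schreier fs \<zeta>)"
      have "thin (range (\<lambda>n :: nat. {n}))" by (auto simp: thin_def initial_segment_def)
      moreover have "thin (schreier fs \<zeta>)" using Suc by (intro less) (simp add: cord_less_add_1)
      ultimately have "thin ?F" by (rule thin_concats)
      moreover have "{n} \<union> r \<in> ?F" if "in_schreier fs \<zeta> r" "set_less {n} r" for n r
      proof -
        have "\<forall>x\<in>{n}. \<forall>y\<in>r. x < y"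
          using set_less_pointwise that in_schreier_finite by blast
        then show ?thesis using that unfolding concats_def schreier_def by blast
      qed
      ultimately show ?thesis using thinD st m Suc by blast
    next
      case (omega_pow_Suc \<beta>)
      have t': "t \<in> successive_unions (schreier fs (omega_pow \<beta>)) (Min t)"
        using in_schreier_omega_pow_Suc_cases t omega_pow_Suc unfolding schreier_def by blast
      have "Min t = Min s"
        using initial_segment_Min[OF st] omega_pow_Suc in_schreier_finite[OF t] by blast
      then have "t \<in> successive_unions (schreier fs (omega_pow \<beta>)) (Min s)"
        "s \<in> successive_unions (schreier fs (omega_pow \<beta>)) (Min s)"
        using t' omega_pow_Suc by (simp_all add: schreier_def)
      moreover have "thin (schreier fs (omega_pow \<beta>))"
        using omega_pow_Suc by (intro less) (simp add: omega_pow_less_iff cord_less_add_1)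
      ultimately show ?thesis using thinD[OF thin_successive_unions] fin st by blast
    next
      case (omega_pow_limit l)
      have t': "in_schreier fs (omega_pow (fs l (Min t))) t"
        using in_schreier_omega_pow_limit_cases t omega_pow_limit by blast
      have "Min t = Min s"
        using initial_segment_Min[OF st] omega_pow_limit in_schreier_finite[OF t] by blast
      then have "t \<in> schreier fs (omega_pow (fs l (Min s)))" "s \<in> schreier fs (omega_pow (fs l (Min s)))"
        using t' omega_pow_limit by (simp_all add: schreier_def)
      moreover have "thin (schreier fs (omega_pow (fs l (Min s))))"
      proof (rule less)
        \<comment> \<open>\<open>fundamental_sequences\<close> speaks only of terms with index at
          least 1.\<close>
        have "Min s \<ge> 1"
          using in_schreier_finite_pos[OF s] omega_pow_limit Min_in by blast
        then show "omega_pow (fs l (Min s)) < \<xi>"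
          using fundamental_sequence_less[OF fs] omega_pow_limit by (simp add: omega_pow_less_iff)
      qed
      ultimately show ?thesis using thinD st by blast
    next
      case (sum cs \<alpha> p cs' ss)
      define Fs where
        "Fs = map (\<lambda>(a, q). successive_unions (schreier fs (omega_pow a)) q) cs"
      have Fsi: "Fs ! i = successive_unions (schreier fs (omega_pow (fst (cs ! i)))) (snd (cs ! i))"
        if "i < length cs" for i using that by (simp add: Fs_def case_prod_beta)
      have len: "length Fs = length cs" by (simp add: Fs_def)
      let ?D = "{\<Union>(set ss) | ss. length ss = length Fs \<and> (\<forall>i<length Fs. ss ! i \<in> Fs ! i) \<and>
        sorted_wrt (\<lambda>s t. set_less t s) ss}"
      have "thin ?D"
      proof (rule thin_decreasing_unions, intro allI impI)
        fix i assume "i < length Fs"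
        then have i: "i < length cs" by (simp add: len)
        have "fst (cs ! i) \<le> \<alpha>"
        proof (cases i)
          case 0 then show ?thesis using sum by simp
        next
          case (Suc j)
          then have "cs ! i \<in> set cs'" using Suc sum(3) i by simp
          moreover have "\<forall>x\<in>set cs'. fst x < \<alpha>" using sum(3,7) by simp
          ultimately show ?thesis by (simp add: less_imp_le)
        qed
        then have "omega_pow (fst (cs ! i)) < \<xi>"
          using sum omega_pow_mono le_less_trans by metis
        then have "thin (schreier fs (omega_pow (fst (cs ! i))))" by (rule less)
        then show "thin (Fs ! i) \<and> (\<forall>s\<in>Fs ! i. finite s)"
          unfolding Fsi[OF i] using thin_successive_unions successive_unions_finite fin by blast
      qed
      moreover have "s \<in> ?D"
        using sum Fsi len unfolding schreier_def by auto
      moreover have "t \<in> ?D"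
      proof -
        obtain ts where "t = \<Union>(set ts)" "length ts = length cs"
          "\<forall>i<length cs. ts ! i \<in>
            successive_unions {t. in_schreier fs (omega_pow (fst (cs ! i))) t} (snd (cs ! i))"
          "sorted_wrt (\<lambda>s t. set_less t s) ts"
          by (rule in_schreier_sum_cases[OF t, of cs \<alpha>]) (use sum in auto)
        then show ?thesis using Fsi len unfolding schreier_def by auto
      qed
      ultimately show ?thesis using thinD st by blast
    qed
  qed
qed

section \<open>Words generated by a sequence of variable words\<close>

lemma dom_subst_word [simp]: "dom (subst_word \<alpha> k \<upsilon> p w) = dom w"
  by (auto simp: subst_word_def dom_def)

lemma dom_star_list: "dom (star_list xs) = (\<Union>x\<in>set xs. dom x)"
  by (induction xs) (auto simp: star_list_Cons star_list_Nil)

lemma var_word_seqs_dom_less: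
  assumes ws: "ws \<in> var_word_seqs \<alpha> k \<upsilon>"
    and "1 \<le> a" "a < b" "i \<in> dom (ws a)" "j \<in> dom (ws b)"
  shows "i < j"
proof -
  have fin: "finite (dom (ws n))" and ne: "dom (ws n) \<noteq> {}"
    and less: "word_less (ws n) (ws (n + 1))" if "n \<ge> 1" for n
    using ws that by (auto simp: var_word_seqs_def var_words_def)
  have "\<forall>j\<in>dom (ws b). i < j"
    using Suc_leI[OF \<open>a < b\<close>]
  proof (induction b rule: dec_induct)
    case base
    show ?case
    proof
      fix j assume "j \<in> dom (ws (Suc a))"
      then have "Min (dom (ws (Suc a))) \<le> j" using fin[of "Suc a"] by simp
      moreover have "i \<le> Max (dom (ws a))" using fin[of a] assms by simp
      ultimately show "i < j" using less[of a] assms(2) by (simp add: word_less_def)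
    qed
  next
    case (step n)
    show ?case
    proof
      fix j assume j: "j \<in> dom (ws (Suc n))"
      have "Max (dom (ws n)) \<in> dom (ws n)" using fin[of n] ne[of n] step.hyps assms(2) by simp
      then have "i < Max (dom (ws n))" using step.IH by blast
      moreover have "Min (dom (ws (Suc n))) \<le> j" using fin[of "Suc n"] j by simp
      ultimately show "i < j" using less[of n] step.hyps assms(2) by (simp add: word_less_def)
    qed
  qed
  then show ?thesis using assms(5) by blast
qed

lemma sorted_wrt_concat:
  "\<forall>xs\<in>set xss. sorted_wrt R xs \<Longrightarrow>
    sorted_wrt (\<lambda>xs ys. \<forall>x\<in>set xs. \<forall>y\<in>set ys. R x y) xss \<Longrightarrow> sorted_wrt R (concat xss)"
  by (induction xss) (auto simp: sorted_wrt_append)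

lemma star_list_singletons:
  "star_list (map (\<lambda>i. [i \<mapsto> f i]) is) j = (if j \<in> set is then Some (f j) else None)"
  by (induction "is") (auto simp: star_list_Cons star_list_Nil map_add_def split: option.split)

text \<open>The minima of \<open>v\<close> form an initial segment of those of \<open>v @ r\<close>,
  so thinness makes the two sets equal. A word of \<open>r\<close> would add a strictly larger
  minimum.\<close>

lemma schreier_tuples_thin:
  assumes fs: "fundamental_sequences fs"
    and v: "v \<in> schreier_tuples fs \<xi> \<alpha> k" and vr: "v @ r \<in> schreier_tuples fs \<xi> \<alpha> k"
  shows "r = []"
proof (rule ccontr)
  assume r: "r \<noteq> []"
  let ?m = "\<lambda>w :: 'a word. Min (dom w)"
  have less: "?m x < ?m y" if "x \<in> set v" "y \<in> set r" for x y
  proof -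
    have "x \<in> words \<alpha> k" "word_less x y"
      using vr that by (auto simp: schreier_tuples_def word_tuples_def sorted_wrt_append)
    then have "?m x \<le> Max (dom x)" "Max (dom x) < ?m y"
      by (simp_all add: words_def word_less_def)
    then show ?thesis by simp
  qed
  have "initial_segment (?m ` set v) (?m ` set (v @ r))"
    unfolding initial_segment_def using less by auto
  then have "?m ` set v = ?m ` set (v @ r)"
    using thin_schreier[OF fs, of \<xi>] v vr by (simp add: thin_def schreier_tuples_def)
  then have "?m (hd r) \<in> ?m ` set v" using r by auto
  then obtain x where "x \<in> set v" "?m x = ?m (hd r)" by auto
  then show False using less[of x "hd r"] r by simp
qed

section \<open>Decoding index words\<close>

locale word_sequence =
  fixes \<alpha> :: "nat \<Rightarrow> 'a" and k :: "nat \<Rightarrow> nat" and \<upsilon> :: 'a and ws :: "nat \<Rightarrow> 'a word"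
  assumes var_notin: "\<upsilon> \<notin> \<alpha> ` {1..}"
    and k_pos: "\<And>n. n \<ge> 1 \<Longrightarrow> k n \<ge> 1"
    and ws: "ws \<in> var_word_seqs \<alpha> k \<upsilon>"
begin

text \<open>The choice is unambiguous, since the domains of the \<open>ws n\<close> are pairwise
  disjoint.\<close>

definition index_of :: "nat \<Rightarrow> nat option" where
  "index_of m = (if \<exists>n\<ge>1. m \<in> dom (ws n) then Some (SOME n. n \<ge> 1 \<and> m \<in> dom (ws n)) else None)"

text \<open>The decoding that sends a letter \<open>p\<close> at index \<open>n\<close> to
  \<open>T_p(w_n)\<close>. Defined pointwise, it is a homomorphism for \<open>++\<close> on all
  index words, whatever their order.\<close>

definition eval_word :: "nat word \<Rightarrow> 'a word" where
  "eval_word x m = (case index_of m of None \<Rightarrow> None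
    | Some n \<Rightarrow> (case x n of None \<Rightarrow> None | Some p \<Rightarrow> subst_word \<alpha> k \<upsilon> p (ws n) m))"

lemma index_of_eq_Some_iff: "index_of m = Some n \<longleftrightarrow> n \<ge> 1 \<and> m \<in> dom (ws n)"
proof
  assume "index_of m = Some n"
  then have "\<exists>n\<ge>1. m \<in> dom (ws n)" "n = (SOME n. n \<ge> 1 \<and> m \<in> dom (ws n))"
    by (auto simp: index_of_def split: if_splits)
  then show "n \<ge> 1 \<and> m \<in> dom (ws n)" by (metis (mono_tags, lifting) someI_ex)
next
  assume n: "n \<ge> 1 \<and> m \<in> dom (ws n)"
  have "n' = n" if n': "n' \<ge> 1 \<and> m \<in> dom (ws n')" for n'
    using var_word_seqs_dom_less[OF ws, of n n' m m] var_word_seqs_dom_less[OF ws, of n' n m m] n n'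
    by (cases n n' rule: linorder_cases) auto
  then have some: "(SOME n. n \<ge> 1 \<and> m \<in> dom (ws n)) = n" using n by (intro some_equality)
  have "\<exists>n\<ge>1. m \<in> dom (ws n)" using n by blast
  then show "index_of m = Some n" by (simp only: index_of_def some if_True)
qed

lemma dom_eval_word: "dom (eval_word x) = (\<Union>n\<in>dom x \<inter> {1..}. dom (ws n))"
proof (intro set_eqI iffI)
  fix m assume "m \<in> dom (eval_word x)"
  then obtain n p where "index_of m = Some n" "x n = Some p"
    by (auto simp: eval_word_def split: option.splits)
  then show "m \<in> (\<Union>n\<in>dom x \<inter> {1..}. dom (ws n))" by (auto simp: index_of_eq_Some_iff)
next
  fix m assume "m \<in> (\<Union>n\<in>dom x \<inter> {1..}. dom (ws n))"
  then obtain n p where n: "n \<ge> 1" "m \<in> dom (ws n)" "x n = Some p" by auto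
  then have "m \<in> dom (subst_word \<alpha> k \<upsilon> p (ws n))" by simp
  then obtain c where "subst_word \<alpha> k \<upsilon> p (ws n) m = Some c" by blast
  then have "eval_word x m = Some c"
    using n index_of_eq_Some_iff[of m n] by (simp add: eval_word_def)
  then show "m \<in> dom (eval_word x)" by blast
qed

lemma eval_word_add: "eval_word (x ++ y) = eval_word x ++ eval_word y"
proof
  fix m
  show "eval_word (x ++ y) m = (eval_word x ++ eval_word y) m"
  proof (cases "index_of m")
    case None
    then show ?thesis by (simp add: eval_word_def map_add_def)
  next
    case (Some n)
    show ?thesis
    proof (cases "y n")
      case None
      then show ?thesis using Some by (simp add: eval_word_def map_add_def)
    next
      case y: (Some p)
      have "m \<in> dom (subst_word \<alpha> k \<upsilon> p (ws n))" using Some by (simp add: index_of_eq_Some_iff)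
      then obtain c where "subst_word \<alpha> k \<upsilon> p (ws n) m = Some c" by blast
      then show ?thesis using Some y by (simp add: eval_word_def map_add_def)
    qed
  qed
qed

lemma eval_word_star_list: "eval_word (star_list xs) = star_list (map eval_word xs)"
proof (induction xs)
  case Nil
  show ?case by (rule ext) (simp add: star_list_Nil eval_word_def split: option.split)
next
  case (Cons x xs)
  then show ?case by (simp add: star_list_Cons eval_word_add)
qed

lemma eval_word_singleton:
  assumes "n \<ge> 1" shows "eval_word [n \<mapsto> p] = subst_word \<alpha> k \<upsilon> p (ws n)"
proof
  fix m
  show "eval_word [n \<mapsto> p] m = subst_word \<alpha> k \<upsilon> p (ws n) m"
  proof (cases "m \<in> dom (ws n)")
    case True
    then show ?thesis using assms index_of_eq_Some_iff[of m n] by (simp add: eval_word_def)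
  next
    case False
    then have "m \<notin> dom (subst_word \<alpha> k \<upsilon> p (ws n))" "m \<notin> dom (eval_word [n \<mapsto> p])"
      by (auto simp: dom_eval_word split: if_splits)
    then show ?thesis by (metis domIff)
  qed
qed

text \<open>The left side truncates \<open>p\<close> at \<open>k n\<close> for the index
  \<open>n\<close>, the right side only at \<open>k m\<close> for the position \<open>m\<close>. The
  bound on \<open>p\<close> makes the first truncation void.\<close>

lemma eval_word_index_subst:
  assumes p: "p \<ge> 1" "\<And>n. n \<in> dom x \<Longrightarrow> p \<le> k n"
  shows "eval_word (index_subst k p x) = subst_word \<alpha> k \<upsilon> p (eval_word x)"
proof
  fix m
  show "eval_word (index_subst k p x) m = subst_word \<alpha> k \<upsilon> p (eval_word x) m"
  proof (cases "index_of m")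
    case None
    then show ?thesis using p by (simp add: eval_word_def subst_word_def)
  next
    case n: (Some n)
    show ?thesis
    proof (cases "x n")
      case None
      then show ?thesis using n p by (simp add: eval_word_def subst_word_def index_subst_def)
    next
      case a: (Some a)
      obtain c where c: "ws n m = Some c" and "n \<ge> 1" using n by (auto simp: index_of_eq_Some_iff)
      have "m \<ge> 1" using c ws \<open>n \<ge> 1\<close> by (auto simp: var_word_seqs_def var_words_def)
      have "p \<le> k n" using p(2) a by blast
      \<comment> \<open>Letters put in by an earlier substitution are not the variable, so the outer
        substitution leaves them alone.\<close>
      have neq: "\<alpha> (min q (k m)) \<noteq> \<upsilon>" if "q \<ge> 1" for q
      proof -
        have "min q (k m) \<in> {1..}" using that k_pos[OF \<open>m \<ge> 1\<close>] by simp
        then show ?thesis using var_notin by blast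
      qed
      show ?thesis
      proof (cases "a = 0")
        case True
        then show ?thesis using n a p(1) \<open>p \<le> k n\<close>
          by (simp add: eval_word_def subst_word_def index_subst_def min_absorb1)
      next
        case False
        then show ?thesis using n a c p(1) neq[of a]
          by (simp add: eval_word_def subst_word_def index_subst_def)
      qed
    qed
  qed
qed

text \<open>The index word is the star of its one-letter pieces in increasing order. Decoding them
  piece by piece gives the required factors, and the letter 0 gives the factor with
  \<open>p = 0\<close>.\<close>

lemma eval_word_in_EV_words:
  assumes x: "var_above k n x"
  shows "eval_word x \<in> EV_words \<alpha> k \<upsilon> ws"
proof -
  let ?is = "sorted_list_of_set (dom x)"
  have fin: "finite (dom x)" and zero: "0 \<in> ran x"
    and xi: "\<And>i a. x i = Some a \<Longrightarrow> n < i \<and> a \<le> k i" using x by (auto simp: var_above_def)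
  have "x = star_list (map (\<lambda>i. [i \<mapsto> the (x i)]) ?is)"
  proof
    fix i show "x i = star_list (map (\<lambda>i. [i \<mapsto> the (x i)]) ?is) i"
      using fin by (auto simp: star_list_singletons)
  qed
  then have "eval_word x = eval_word (star_list (map (\<lambda>i. [i \<mapsto> the (x i)]) ?is))"
    by (rule arg_cong)
  also have "\<dots> = star_list (map eval_word (map (\<lambda>i. [i \<mapsto> the (x i)]) ?is))"
    by (rule eval_word_star_list)
  also have "map eval_word (map (\<lambda>i. [i \<mapsto> the (x i)]) ?is) =
      map (\<lambda>(n, p). subst_word \<alpha> k \<upsilon> p (ws n)) (map (\<lambda>i. (i, the (x i))) ?is)"
  proof -
    have "eval_word [i \<mapsto> the (x i)] = subst_word \<alpha> k \<upsilon> (the (x i)) (ws i)" if "i \<in> dom x" for i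
      using that xi by (intro eval_word_singleton) fastforce
    then show ?thesis using fin by simp
  qed
  finally have eq: "eval_word x =
      star_list (map (\<lambda>(n, p). subst_word \<alpha> k \<upsilon> p (ws n)) (map (\<lambda>i. (i, the (x i))) ?is))" .
  have "dom x \<noteq> {}" using zero by (auto simp: ran_def)
  moreover have "sorted_wrt (<) (map fst (map (\<lambda>i. (i, the (x i))) ?is))"
    by (simp add: comp_def strict_sorted_list_of_set)
  moreover have "\<forall>(i, p)\<in>set (map (\<lambda>i. (i, the (x i))) ?is). i \<ge> 1 \<and> p \<le> k i"
    using fin xi by fastforce
  moreover have "\<exists>(i, p)\<in>set (map (\<lambda>i. (i, the (x i))) ?is). p = 0"
    using fin zero by (force simp: ran_def)
  ultimately show ?thesis unfolding EV_words_def
    by (intro CollectI exI[of _ "map (\<lambda>i. (i, the (x i))) ?is"] conjI eq) (use fin in simp_all)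
qed

lemma eval_word_in_var_words:
  assumes x: "var_above k n x"
  shows "eval_word x \<in> var_words \<alpha> k \<upsilon>"
proof -
  have ws1: "ws i \<in> var_words \<alpha> k \<upsilon>" if "i \<ge> 1" for i using ws that by (simp add: var_word_seqs_def)
  have fin: "finite (dom x)" and xi: "\<And>i a. x i = Some a \<Longrightarrow> n < i \<and> a \<le> k i"
    using x by (auto simp: var_above_def)
  obtain i where i: "x i = Some 0" using x by (auto simp: var_above_def ran_def)
  have i1: "i \<ge> 1" using xi[OF i] by simp
  then obtain m where m: "ws i m = Some \<upsilon>" using ws1[of i] by (auto simp: var_words_def ran_def)
  then have "index_of m = Some i" using i1 by (auto simp: index_of_eq_Some_iff)
  then have "eval_word x m = Some \<upsilon>" using i m by (simp add: eval_word_def subst_word_def)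
  then have "\<upsilon> \<in> ran (eval_word x)" by (rule ranI)
  moreover have "dom (eval_word x) \<noteq> {}" using \<open>eval_word x m = Some \<upsilon>\<close> by auto
  moreover have "finite (dom (eval_word x))" "dom (eval_word x) \<subseteq> {1..}"
    unfolding dom_eval_word using fin ws1 by (auto simp: var_words_def)
  moreover have "c \<in> insert \<upsilon> (\<alpha> ` {1..k m})" if xm: "eval_word x m = Some c" for m c
  proof -
    obtain j where j0: "index_of m = Some j"
      using xm by (cases "index_of m") (simp_all add: eval_word_def)
    obtain a where a: "x j = Some a"
      using xm j0 by (cases "x j") (simp_all add: eval_word_def)
    have "subst_word \<alpha> k \<upsilon> a (ws j) m = Some c" using xm j0 a by (simp add: eval_word_def)
    note j = j0 a this
    then have j1: "j \<ge> 1" "m \<in> dom (ws j)" by (simp_all add: index_of_eq_Some_iff)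
    then obtain d where d: "ws j m = Some d" by blast
    have "dom (ws j) \<subseteq> {1..}" and "\<forall>m\<in>dom (ws j). the (ws j m) \<in> insert \<upsilon> (\<alpha> ` {1..k m})"
      using ws1[OF j1(1)] unfolding var_words_def by blast+
    then have "m \<in> {1..}" and dd': "the (ws j m) \<in> insert \<upsilon> (\<alpha> ` {1..k m})"
      using j1(2) by blast+
    then have "m \<ge> 1" and dd: "d \<in> insert \<upsilon> (\<alpha> ` {1..k m})" using d by simp_all
    show ?thesis
    proof (cases "a = 0 \<or> d \<noteq> \<upsilon>")
      case True
      then show ?thesis using j(3) d dd by (auto simp: subst_word_def split: if_splits)
    next
      case False
      then have "c = \<alpha> (min a (k m))" using j(3) d by (simp add: subst_word_def)
      then show ?thesis using False k_pos[OF \<open>m \<ge> 1\<close>] by auto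
    qed
  qed
  then have "\<forall>m\<in>dom (eval_word x). the (eval_word x m) \<in> insert \<upsilon> (\<alpha> ` {1..k m})"
    by (metis domD option.sel)
  ultimately show ?thesis unfolding var_words_def by blast
qed

end

section \<open>The dichotomy for a given family of tuples\<close>

theorem theorem2p8:
  fixes fs :: "cord \<Rightarrow> nat \<Rightarrow> cord"
    and \<xi> :: cord
    and \<alpha> :: "nat \<Rightarrow> 'a"
    and \<upsilon> :: 'a
    and k :: "nat \<Rightarrow> nat"
    and G :: "'a word list set"
    and ws :: "nat \<Rightarrow> 'a word"
  assumes "fundamental_sequences fs"
    and "\<xi> \<ge> 1"
    and "inj_on \<alpha> {1..}"
    and "\<upsilon> \<notin> \<alpha> ` {1..}"
    and "\<forall>n\<ge>1. k n \<ge> 1"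
    and "mono_on {1..} k"
    and "G \<subseteq> word_tuples \<alpha> k"
    and "ws \<in> var_word_seqs \<alpha> k \<upsilon>"
  shows "\<exists>us. extraction \<alpha> k \<upsilon> us ws \<and>
    (schreier_tuples fs \<xi> \<alpha> k \<inter> E_tuples \<alpha> k \<upsilon> us \<subseteq> G \<or>
     schreier_tuples fs \<xi> \<alpha> k \<inter> E_tuples \<alpha> k \<upsilon> us \<subseteq> word_tuples \<alpha> k - G)"
proof -
  interpret word_sequence \<alpha> k \<upsilon> ws using assms by unfold_locales auto
  obtain U V where U: "ultra U" "ultra_prod (++) U U = U" and V: "ultra V"
    "\<And>n. V (var_above k n)" "\<And>p. p \<ge> 1 \<Longrightarrow> ultra_map (index_subst k p) V = U"
    using variable_idempotent_pair[of k, OF k_pos] by metis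
  let ?L = "schreier_tuples fs \<xi> \<alpha> k"
  \<comment> \<open>The ultrafilters live on index words, so families of tuples are pulled back
    along the decoding.\<close>
  define pull where "pull F = {s. map eval_word s \<in> F}" for F :: "'a word list set"
  \<comment> \<open>Rejection is the property \<open>good\<close> of \<open>fusion\<close>. Decoding
    the resulting index words gives an extraction whose generated tuples are all rejected, hence
    outside \<open>F\<close>.\<close>
  have avoid: "\<exists>us. extraction \<alpha> k \<upsilon> us ws \<and> E_tuples \<alpha> k \<upsilon> us \<inter> F = {}"
    if F: "\<not> accepts U (pull F) []" for F
  proof -
    obtain u where u: "\<And>n. var_above k n (u (Suc n))"
      and uless: "\<And>n i j. i \<in> dom (u (Suc n)) \<Longrightarrow> j \<in> dom (u (Suc (Suc n))) \<Longrightarrow> i < j"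
      and good: "\<And>npss. [] \<notin> set npss \<Longrightarrow> sorted_wrt (<) (map fst (concat npss)) \<Longrightarrow>
        \<forall>(n, p)\<in>set (concat npss). 1 \<le> n \<and> 1 \<le> p \<and> p \<le> k n \<Longrightarrow>
        \<not> accepts U (pull F) (map (index_star k u) npss)"
    proof (rule fusion[where k = k and good = "\<lambda>s. \<not> accepts U (pull F) s", OF U V(1,2)])
      show "ultra_map (index_subst k p) V = U" if "1 \<le> p" for p using that by (rule V(3))
      show "U (\<lambda>w. \<not> accepts U (pull F) (s @ [w]))" if "\<not> accepts U (pull F) s" for s
        using U(1) that by (rule rejects_extend)
      show "\<not> accepts U (pull F) []" by (rule F)
    qed (rule that)
    define us where "us n = eval_word (u n)" for n
    have un: "var_above k (n - 1) (u n)" if "n \<ge> 1" for n using u[of "n - 1"] that by simp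
    have us_var: "us n \<in> var_words \<alpha> k \<upsilon>" if "n \<ge> 1" for n
      unfolding us_def using un[OF that] by (rule eval_word_in_var_words)
    have us_less: "word_less (us n) (us (n + 1))" if "n \<ge> 1" for n
    proof -
      have "i < j" if i: "i \<in> dom (us n)" and j: "j \<in> dom (us (n + 1))" for i j
      proof -
        obtain a b where "a \<in> dom (u n)" "1 \<le> a" "i \<in> dom (ws a)"
          "b \<in> dom (u (n + 1))" "j \<in> dom (ws b)"
          using i j by (auto simp: us_def dom_eval_word)
        moreover from this have "a < b" using uless[of a "n - 1" b] \<open>n \<ge> 1\<close> by simp
        ultimately show ?thesis using var_word_seqs_dom_less[OF ws] by blast
      qed
      moreover have "finite (dom (us n))" "dom (us n) \<noteq> {}"
        "finite (dom (us (n + 1)))" "dom (us (n + 1)) \<noteq> {}"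
        using us_var[of n] us_var[of "n + 1"] that by (simp_all add: var_words_def)
      ultimately show ?thesis by (simp add: word_less_def)
    qed
    have us: "us \<in> var_word_seqs \<alpha> k \<upsilon>" using us_var us_less by (simp add: var_word_seqs_def)
    have "us n \<in> EV_words \<alpha> k \<upsilon> ws" if "n \<ge> 1" for n
      unfolding us_def using un[OF that] by (rule eval_word_in_EV_words)
    then have ext: "extraction \<alpha> k \<upsilon> us ws" using us by (simp add: extraction_def)
    have "vs \<notin> F" if vs: "vs \<in> E_tuples \<alpha> k \<upsilon> us" for vs
    proof -
      define E where "E w nps \<longleftrightarrow> w = star_list (map (\<lambda>(n, p). subst_word \<alpha> k \<upsilon> p (us n)) nps) \<and>
        nps \<noteq> [] \<and> sorted_wrt (<) (map fst nps) \<and> (\<forall>(n, p)\<in>set nps. n \<ge> 1 \<and> 1 \<le> p \<and> p \<le> k n)"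
        for w nps
      have "\<forall>w\<in>set vs. \<exists>nps. E w nps"
        using vs by (auto simp: E_tuples_def E_words_def E_def)
      \<comment> \<open>\<open>g\<close> fixes one representation of each word of the tuple as a
        list of index-letter pairs.\<close>
      then obtain g where g: "\<And>w. w \<in> set vs \<Longrightarrow> E w (g w)" by metis
      have g_ne: "g w \<noteq> []" and g_sorted: "sorted_wrt (<) (map fst (g w))"
        and g_bounds: "\<forall>(n, p)\<in>set (g w). n \<ge> 1 \<and> 1 \<le> p \<and> p \<le> k n"
        if "w \<in> set vs" for w
        using g[OF that] unfolding E_def by blast+
      let ?npss = "map g vs"
      have E_dom: "dom (us n) \<subseteq> dom w" if "E w nps" "(n, p) \<in> set nps" for w nps n p
      proof -
        have w: "w = star_list (map (\<lambda>(n, p). subst_word \<alpha> k \<upsilon> p (us n)) nps)"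
          using that(1) by (simp add: E_def)
        have "subst_word \<alpha> k \<upsilon> p (us n) \<in> set (map (\<lambda>(n, p). subst_word \<alpha> k \<upsilon> p (us n)) nps)"
          using that(2) by force
        then have "dom (subst_word \<alpha> k \<upsilon> p (us n)) \<subseteq> dom w" unfolding w dom_star_list by blast
        then show ?thesis by simp
      qed
      have dom_g: "dom (us n) \<subseteq> dom w" if "w \<in> set vs" "(n, p) \<in> set (g w)" for w n p
        using g[OF that(1)] that(2) by (rule E_dom)
      \<comment> \<open>Successive words use successive blocks of indices, since equal or reversed
        indices would contradict the order of the domains. The concatenated list is therefore
        increasing, as \<open>fusion\<close> requires.\<close>
      have g_less: "a < b"
        if "word_less w w'" "w \<in> set vs" "w' \<in> set vs" "(a, p) \<in> set (g w)" "(b, q) \<in> set (g w')"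
        for w w' a b p q
      proof -
        have a1: "a \<ge> 1" and b1: "b \<ge> 1" using g_bounds that(2-5) by fast+
        have fin: "finite (dom w)" "finite (dom w')"
          using vs that(2,3) by (auto simp: E_tuples_def word_tuples_def words_def)
        have less: "i < j" if "i \<in> dom (us a)" "j \<in> dom (us b)" for i j
        proof -
          have "i \<in> dom w" "j \<in> dom w'"
            using dom_g[OF \<open>w \<in> set vs\<close> \<open>(a, p) \<in> set (g w)\<close>]
              dom_g[OF \<open>w' \<in> set vs\<close> \<open>(b, q) \<in> set (g w')\<close>] that by auto
          then have "i \<le> Max (dom w)" "Min (dom w') \<le> j" using fin by simp_all
          then show ?thesis using \<open>word_less w w'\<close> by (simp add: word_less_def)
        qed
        obtain i j where ij: "i \<in> dom (us a)" "j \<in> dom (us b)"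
          using us_var[OF a1] us_var[OF b1] unfolding var_words_def by blast
        show "a < b"
        proof (rule ccontr)
          assume "\<not> a < b"
          then consider "a = b" | "b < a" by linarith
          then show False
          proof cases
            case 1
            then show ?thesis using less[of i i] ij by simp
          next
            case 2
            then show ?thesis
              using less[OF ij] var_word_seqs_dom_less[OF us b1 2 ij(2,1)] by simp
          qed
        qed
      qed
      have "sorted_wrt word_less vs" using vs by (simp add: E_tuples_def word_tuples_def)
      then have "sorted_wrt (\<lambda>w w'. \<forall>x\<in>set (g w). \<forall>y\<in>set (g w'). fst x < fst y) vs"
        by (rule sorted_wrt_mono_rel[rotated]) (use g_less in fastforce)
      then have "sorted_wrt (\<lambda>x y. fst x < fst y) (concat ?npss)"
        using g_sorted by (intro sorted_wrt_concat) (auto simp: sorted_wrt_map)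
      then have "sorted_wrt (<) (map fst (concat ?npss))" by (simp add: sorted_wrt_map)
      moreover have "[] \<notin> set ?npss" using g_ne by force
      moreover have bounds: "\<forall>(n, p)\<in>set (concat ?npss). 1 \<le> n \<and> 1 \<le> p \<and> p \<le> k n"
        using g_bounds by fastforce
      ultimately have rej: "\<not> accepts U (pull F) (map (index_star k u) ?npss)" by (intro good)
      have "eval_word (index_star k u (g w)) = w" if w: "w \<in> set vs" for w
      proof -
        have "eval_word (index_subst k p (u n)) = subst_word \<alpha> k \<upsilon> p (us n)"
          if np: "(n, p) \<in> set (g w)" for n p
        proof -
          have n: "1 \<le> n" "1 \<le> p" "p \<le> k n" using g_bounds[OF w] np by blast+
          \<comment> \<open>Monotonicity of \<open>k\<close> enters here: the positions of
            \<open>u n\<close> are at least \<open>n\<close>, so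
            \<open>p \<le> k n \<le> k i\<close>, and decoding commutes with the
            substitution.\<close>
          have "p \<le> k i" if i: "i \<in> dom (u n)" for i
          proof -
            have "n - 1 < i" using un[OF n(1)] i unfolding var_above_def by blast
            then have "n \<le> i" by simp
            then have "k n \<le> k i" using assms(6) n(1) by (auto simp: monotone_on_def)
            then show ?thesis using n(3) by simp
          qed
          then show ?thesis unfolding us_def using n(2) by (intro eval_word_index_subst)
        qed
        then have eq: "map eval_word (map (\<lambda>(n, p). index_subst k p (u n)) (g w)) =
            map (\<lambda>(n, p). subst_word \<alpha> k \<upsilon> p (us n)) (g w)" by auto
        have "star_list (map (\<lambda>(n, p). subst_word \<alpha> k \<upsilon> p (us n)) (g w)) = w"
          using g[OF w] unfolding E_def by (elim conjE) (rule sym)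
        then show ?thesis unfolding index_star_def eval_word_star_list eq .
      qed
      then have "map eval_word (map (index_star k u) ?npss) = vs"
        by (simp add: map_idI)
      moreover have "map (index_star k u) ?npss \<notin> pull F"
        using rej accepts.member[of _ "pull F" U] by blast
      ultimately show ?thesis by (simp add: pull_def)
    qed
    then show ?thesis using ext by blast
  qed
  have "\<not> accepts U (pull (?L \<inter> G)) [] \<or> \<not> accepts U (pull (?L - G)) []"
  proof -
    \<comment> \<open>By thinness an extension within \<open>?L\<close> adds nothing, so the same
      decoded tuple would lie in both \<open>A\<close> and \<open>B\<close>.\<close>
    have disj: "s @ r \<notin> pull B"
      if "A \<subseteq> ?L" "B \<subseteq> ?L" "A \<inter> B = {}" "s \<in> pull A" for A B s r
    proof
      assume "s @ r \<in> pull B"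
      then have B: "map eval_word s @ map eval_word r \<in> B" and A: "map eval_word s \<in> A"
        using that(4) by (simp_all add: pull_def)
      then have "map eval_word r = []"
        using schreier_tuples_thin[OF assms(1)] that(1,2) by blast
      then show False using A B that(3) by auto
    qed
    have "s @ r \<notin> pull (?L - G)" if "s \<in> pull (?L \<inter> G)" for s r
      by (rule disj[OF _ _ _ that]) auto
    moreover have "s @ r \<notin> pull (?L \<inter> G)" if "s \<in> pull (?L - G)" for s r
      by (rule disj[OF _ _ _ that]) auto
    ultimately show ?thesis
      using not_accepts_both[OF U(1), of "pull (?L \<inter> G)" "pull (?L - G)" "[]"] by simp
  qed
  then show ?thesis
  proof
    \<comment> \<open>Avoiding \<open>?L \<inter> G\<close> gives the second alternative; avoiding
      \<open>?L - G\<close> gives the first.\<close>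
    assume "\<not> accepts U (pull (?L \<inter> G)) []"
    then obtain us where "extraction \<alpha> k \<upsilon> us ws" "E_tuples \<alpha> k \<upsilon> us \<inter> (?L \<inter> G) = {}"
      using avoid by blast
    moreover have "?L \<subseteq> word_tuples \<alpha> k" by (auto simp: schreier_tuples_def)
    ultimately show ?thesis by blast
  next
    assume "\<not> accepts U (pull (?L - G)) []"
    then obtain us where "extraction \<alpha> k \<upsilon> us ws" "E_tuples \<alpha> k \<upsilon> us \<inter> (?L - G) = {}"
      using avoid by blast
    then show ?thesis by blast
  qed
qed

end
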